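(* Let $p$ be an odd prime, $m\ge1$, $Q=T_{(p^m)}$, $K=K_Q(p)$ and $n\ge1$. Let $K^{\otimes n}_{(p)}=\{M\in K^{\otimes n}:M^p=\mathbbm{1}\}$ and let $\phi:K^{\otimes n}_{(p)}\to H^{\otimes n}(\mathbb{Z}_p)$ be the map defined below. Then for all $M,M'\in K^{\otimes n}_{(p)}$ with $[M,M']=\mathbbm{1}$ we have $\phi(MM')=\phi(M)\phi(M')$; that is, $\phi$ restricts to a group homomorphism on every $p$-torsion abelian subgroup of $K^{\otimes n}$.
   Context: Let $\omega=e^{2\pi i/p}$, $\{|q\rangle:q\in\mathbb{Z}_p\}$ the computational basis of $\mathbb{C}^p$, $X|q\rangle=|q+1\rangle$. For $\xi:\mathbb{Z}_p\to U(1)$ let $S_\xi=\mathrm{diag}(\xi(0),\dots,\xi(p-1))$. $T=\{S_\xi:\prod_{q}\xi(q)=1\}$, $T_{(p^k)}=\{S\in T:S^{p^k}=\mathbbm{1}\}$. $K_Q(p)$ is the subgroup of $SU(p)$ generated by all $S_\xi X^b$, $S_\xi\in Q$, $b\in\mathbb{Z}_p$; each element is uniquely $S_\xi X^b$. $K^{\otimes n}$ is the group of Kronecker products $M_1\otimes\cdots\otimes M_n$ with $M_i\in K$. $H(\mathbb{Z}_p)$ is the Heisenberg–Weyl group generated by $X$ and $Z=\mathrm{diag}(1,\omega,\dots,\omega^{p-1})$, and $H^{\otimes n}(\mathbb{Z}_p)$ the group of $n$-fold Kronecker products of its elements. Every $S_\xi\in T_{(p^m)}$ has a unique expansion $\xi(q)=\exp\big(\sum_{j=1}^m\frac{2\pi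 i}{p^j}\sum_{a=0}^{p-1}\vartheta_{j,a}q^a\big)$ with $\vartheta_{j,a}\in\{0,\dots,p-1\}$ (set $\vartheta_{2,0}=0$ if $m=1$). Define $R(\xi)(q)=\omega^{\vartheta_{1,0}+\vartheta_{1,1}q}e^{2\pi i\vartheta_{2,0}/p^2}$ and $P(\xi)(q)=\omega^{\vartheta_{1,0}+\vartheta_{1,1}q}$. Define $\phi_1$ on $K$ by $\phi_1(S_\xi)=S_{R(\xi)}$, $\phi_1(S_\xi X)=S_{P(\xi)}X$, and for $2\le b\le p-1$, $\phi_1(M)=\phi_1(M^{y})^{b}$ where $M=S_\xi X^b$ and $yb\equiv1\bmod p$. Then $\phi(M_1\otimes\cdots\otimes M_n)=\phi_1(M_1)\otimes\cdots\otimes\phi_1(M_n)$. The commutator is $[A,B]=ABA^{-1}B^{-1}$. *)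

theory Defs
  imports Complex_Main "HOL-Number_Theory.Cong" "Jordan_Normal_Form.Matrix"
begin

definition kron :: "complex mat \<Rightarrow> complex mat \<Rightarrow> complex mat" where
  "kron A B = mat (dim_row A * dim_row B) (dim_col A * dim_col B)
     (\<lambda>(i,j). A $$ (i div dim_row B, j div dim_col B) * B $$ (i mod dim_row B, j mod dim_col B))"

definition kron_list :: "complex mat list \<Rightarrow> complex mat" where
  "kron_list Ms = foldr kron Ms (1\<^sub>m 1)"

definition omega :: "nat \<Rightarrow> complex" where
  "omega p = exp (2 * pi * \<i> / of_nat p)"

definition Smat :: "nat \<Rightarrow> (nat \<Rightarrow> complex) \<Rightarrow> complex mat" where
  "Smat p \<xi> = mat p p (\<lambda>(i,j). if i = j then \<xi> i else 0)"

definition Xmat :: "nat \<Rightarrow> complex mat" where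
  "Xmat p = mat p p (\<lambda>(i,j). if i = (j + 1) mod p then 1 else 0)"

definition Zmat :: "nat \<Rightarrow> complex mat" where
  "Zmat p = Smat p (\<lambda>q. omega p ^ q)"

definition inT :: "nat \<Rightarrow> (nat \<Rightarrow> complex) \<Rightarrow> bool" where
  "inT p \<xi> \<longleftrightarrow> (\<forall>q<p. cmod (\<xi> q) = 1) \<and> (\<Prod>q<p. \<xi> q) = 1"

definition inTpow :: "nat \<Rightarrow> nat \<Rightarrow> (nat \<Rightarrow> complex) \<Rightarrow> bool" where
  "inTpow p m \<xi> \<longleftrightarrow> inT p \<xi> \<and> Smat p \<xi> ^\<^sub>m (p ^ m) = 1\<^sub>m p"

(* K = K_Q(p) with Q = T_(p^m): every element is S_xi X^b *)
definition Kset :: "nat \<Rightarrow> nat \<Rightarrow> complex mat set" where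
  "Kset p m = {Smat p \<xi> * Xmat p ^\<^sub>m b | \<xi> b. inTpow p m \<xi> \<and> b < p}"

(* the coefficients theta_{j,a} of S_xi \<in> T_(p^m); theta j a = 0 outside 1<=j<=m, a<p
   (in particular theta 2 0 = 0 if m = 1) *)
definition theta :: "nat \<Rightarrow> nat \<Rightarrow> (nat \<Rightarrow> complex) \<Rightarrow> nat \<Rightarrow> nat \<Rightarrow> nat" where
  "theta p m \<xi> = (THE th. (\<forall>j a. th j a < p) \<and>
       (\<forall>j a. (j < 1 \<or> m < j \<or> p \<le> a) \<longrightarrow> th j a = 0) \<and>
       (\<forall>q<p. \<xi> q = exp (2 * pi * \<i> *
           (\<Sum>j\<in>{1..m}. (\<Sum>a<p. of_nat (th j a * q ^ a)) / of_nat (p ^ j)))))"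

definition Rfun :: "nat \<Rightarrow> nat \<Rightarrow> (nat \<Rightarrow> complex) \<Rightarrow> nat \<Rightarrow> complex" where
  "Rfun p m \<xi> q = omega p ^ (theta p m \<xi> 1 0 + theta p m \<xi> 1 1 * q)
      * exp (2 * pi * \<i> * of_nat (theta p m \<xi> 2 0) / of_nat (p ^ 2))"

definition Pfun :: "nat \<Rightarrow> nat \<Rightarrow> (nat \<Rightarrow> complex) \<Rightarrow> nat \<Rightarrow> complex" where
  "Pfun p m \<xi> q = omega p ^ (theta p m \<xi> 1 0 + theta p m \<xi> 1 1 * q)"

definition Kdecomp :: "nat \<Rightarrow> nat \<Rightarrow> complex mat \<Rightarrow> (nat \<Rightarrow> complex) \<times> nat" where
  "Kdecomp p m M = (SOME (\<xi>, b). inTpow p m \<xi> \<and> b < p \<and> M = Smat p \<xi> * Xmat p ^\<^sub>m b)"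

(* phi_1 on elements S_xi X^b with b \<in> {0,1} *)
definition phi1_base :: "nat \<Rightarrow> nat \<Rightarrow> complex mat \<Rightarrow> complex mat" where
  "phi1_base p m M = (case Kdecomp p m M of (\<xi>, b) \<Rightarrow>
      if b = 0 then Smat p (Rfun p m \<xi>) else Smat p (Pfun p m \<xi>) * Xmat p)"

definition phi1 :: "nat \<Rightarrow> nat \<Rightarrow> complex mat \<Rightarrow> complex mat" where
  "phi1 p m M = (let b = snd (Kdecomp p m M) in
      if b \<le> 1 then phi1_base p m M
      else (let y = (SOME y. y < p \<and> [y * b = 1] (mod p))
            in phi1_base p m (M ^\<^sub>m y) ^\<^sub>m b))"

(* phi(M_1 \<otimes> ... \<otimes> M_n) = phi_1(M_1) \<otimes> ... \<otimes> phi_1(M_n) *)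
definition phi :: "nat \<Rightarrow> nat \<Rightarrow> complex mat list \<Rightarrow> complex mat" where
  "phi p m Ms = kron_list (map (phi1 p m) Ms)"

end

theory Submission
  imports Defs "HOL-Number_Theory.Residues" "HOL-Computational_Algebra.Polynomial"
begin

text \<open>If \<open>M\<close> and \<open>M'\<close> commute and have \<open>p\<close>-th power one, then in each tensor factor the components
  \<open>A\<close>, \<open>B\<close> commute up to a scalar and have scalar \<open>p\<close>-th power. This already implies
  \<open>\<phi>\<^sub>1 (A B) = \<phi>\<^sub>1 A \<phi>\<^sub>1 B\<close> factor by factor. If one of \<open>A\<close>, \<open>B\<close> is not diagonal, it is a power \<open>N\<^sup>k\<close>
  of some \<open>N = S\<^sub>\<xi> X\<close>, and the other one is \<open>D N\<^sup>j\<close> where the diagonal matrix \<open>D\<close> commutes with \<open>N\<close> up to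
  a scalar, so that its entries are \<open>\<omega> ^ (a + c q)\<close>; on such elements \<open>\<phi>\<^sub>1 (D N\<^sup>j) = D (\<phi>\<^sub>1 N)\<^sup>j\<close>. If both are diagonal,
  scalar \<open>p\<close>-th powers force \<open>\<xi> q = exp (2 \<pi> \<i> s / p\<^sup>2) \<omega> ^ f(q)\<close> with a polynomial \<open>f\<close>, and \<open>R\<close> is
  multiplicative there: the carry from adding the \<open>s\<close> goes to the constant term of \<open>f\<close>, which \<open>R\<close>
  retains.\<close>

subsection \<open>Interpolation modulo a prime\<close>

text \<open>By Fermat the power \<open>p - 1\<close> sends every nonzero residue to 1, so this
  expression is the indicator function of the point \<open>i\<close>. It serves as a Lagrange basis
  polynomial whose construction needs no division.\<close>

lemma fermat_indicator:
  fixes p q i :: nat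
  assumes "prime p" "q < p" "i < p"
  shows "[1 - (int q - int i) ^ (p - 1) = (if q = i then 1 else 0)] (mod int p)"
proof (cases "q = i")
  case True
  then show ?thesis using prime_gt_1_nat[OF assms(1)] by (simp add: power_0_left)
next
  case False
  \<comment> \<open>The difference may be negative, while Fermat's theorem is applied to natural
    numbers; hence the passage to its residue.\<close>
  define d where "d = nat ((int q - int i) mod int p)"
  have d: "int d = (int q - int i) mod int p"
    using prime_gt_1_nat[OF assms(1)] by (simp add: d_def)
  have "\<not> p dvd d"
  proof
    assume "p dvd d"
    then have "int p dvd int q - int i" using d by (metis dvd_mod_iff dvd_refl int_dvd_int_iff)
    then have "\<bar>int p\<bar> \<le> \<bar>int q - int i\<bar>" using False by (intro dvd_imp_le_int) auto
    then show False using assms by linarith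
  qed
  then have "[d ^ (p - 1) = 1] (mod p)" using assms(1) by (rule fermat_theorem[rotated])
  then have "[int d ^ (p - 1) = 1] (mod int p)"
    using cong_int_iff[of "d ^ (p - 1)" 1 p] by simp
  moreover have "[int d ^ (p - 1) = (int q - int i) ^ (p - 1)] (mod int p)"
    by (intro cong_pow) (simp add: d cong_def)
  ultimately have "[(int q - int i) ^ (p - 1) = 1] (mod int p)"
    by (meson cong_sym cong_trans)
  then show ?thesis using False by (simp add: cong_diff_iff_cong_0 cong_sym)
qed

text \<open>The values \<open>k i\<close>, weighted by the indicator polynomials of the points
  \<open>i\<close>, sum to an integer polynomial of degree at most \<open>p - 1\<close>; its
  coefficients are then reduced modulo \<open>p\<close>. Setting \<open>t\<close> to 0 from
  \<open>p\<close> on matches the normalisation in \<open>theta\<close>.\<close>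

lemma interpolation_mod_prime:
  fixes p :: nat and k :: "nat \<Rightarrow> nat"
  assumes "prime p"
  obtains t where "\<And>a. t a < p" "\<And>a. p \<le> a \<Longrightarrow> t a = 0"
    "\<And>q. q < p \<Longrightarrow> [(\<Sum>a<p. t a * q ^ a) = k q] (mod p)"
proof -
  have p0: "0 < p" using prime_gt_0_nat[OF assms] .
  define P :: "int poly" where "P = (\<Sum>i<p. smult (int (k i)) (1 - [:- int i, 1:] ^ (p - 1)))"
  have deg: "degree P \<le> p - 1"
    unfolding P_def
    by (intro degree_sum_le order.trans[OF degree_smult_le] degree_diff_le
        order.trans[OF degree_power_le]) auto
  have val: "[poly P (int q) = int (k q)] (mod int p)" if "q < p" for q
  proof -
    have "poly P (int q) = (\<Sum>i<p. int (k i) * (1 - (int q - int i) ^ (p - 1)))"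
      by (simp add: P_def poly_sum)
    also have "[\<dots> = (\<Sum>i<p. int (k i) * (if q = i then 1 else 0))] (mod int p)"
      using that by (intro cong_sum cong_mult cong_refl fermat_indicator[OF assms]) auto
    also have "(\<Sum>i<p. int (k i) * (if q = i then 1 else 0)) = int (k q)"
    proof -
      have "(\<Sum>i<p. int (k i) * (if q = i then 1 else 0)) = (\<Sum>i<p. if q = i then int (k i) else 0)"
        by (intro sum.cong) auto
      then show ?thesis using that by (simp add: sum.delta')
    qed
    finally show ?thesis .
  qed
  define t where "t a = (if a < p then nat (coeff P a mod int p) else 0)" for a
  show ?thesis
  proof
    show "t a < p" for a using p0 by (simp add: t_def nat_less_iff)
    show "t a = 0" if "p \<le> a" for a using that by (simp add: t_def)
    show "[(\<Sum>a<p. t a * q ^ a) = k q] (mod p)" if q: "q < p" for q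
    proof -
      have "int (\<Sum>a<p. t a * q ^ a) = (\<Sum>a<p. (coeff P a mod int p) * int q ^ a)"
        using p0 by (simp add: t_def)
      also have "[\<dots> = (\<Sum>a<p. coeff P a * int q ^ a)] (mod int p)"
        by (intro cong_sum cong_mult cong_refl) (simp add: cong_def)
      also have "(\<Sum>a<p. coeff P a * int q ^ a) = poly P (int q)"
        unfolding poly_altdef
        by (rule sum.mono_neutral_right) (use deg p0 in \<open>auto simp: coeff_eq_0\<close>)
      also have "[\<dots> = int (k q)] (mod int p)" using val[OF q] .
      finally show ?thesis using cong_int_iff by blast
    qed
  qed
qed

text \<open>Uniqueness follows from existence by counting: evaluation maps the coefficient vectors onto a
  finite set of the same size.\<close>

lemma interpolation_mod_prime_unique:
  fixes p :: nat and s t :: "nat \<Rightarrow> nat"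
  assumes "prime p" and "\<And>a. a < p \<Longrightarrow> s a < p" "\<And>a. a < p \<Longrightarrow> t a < p"
    and eq: "\<And>q. q < p \<Longrightarrow> [(\<Sum>a<p. s a * q ^ a) = (\<Sum>a<p. t a * q ^ a)] (mod p)"
    and "a < p"
  shows "s a = t a"
proof -
  define V where "V = PiE {..<p} (\<lambda>_. {..<p})"
  define ev where "ev u = restrict (\<lambda>q. (\<Sum>a<p. u a * q ^ a) mod p) {..<p}" for u
  have p0: "0 < p" using prime_gt_0_nat[OF assms(1)] .
  have fin: "finite V" unfolding V_def by (intro finite_PiE) auto
  have "V \<subseteq> ev ` V"
  proof
    fix v assume v: "v \<in> V"
    obtain u where u: "\<And>a. u a < p"
      "\<And>q. q < p \<Longrightarrow> [(\<Sum>a<p. u a * q ^ a) = v q] (mod p)"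
      using interpolation_mod_prime[OF assms(1)] by metis
    have "ev (restrict u {..<p}) = v"
    proof
      fix q show "ev (restrict u {..<p}) q = v q"
        using u(2)[of q] v by (cases "q < p") (auto simp: ev_def V_def cong_def PiE_iff extensional_def)
    qed
    moreover have "restrict u {..<p} \<in> V" using u(1) by (auto simp: V_def)
    ultimately show "v \<in> ev ` V" by blast
  qed
  moreover have "ev ` V \<subseteq> V" 
    using p0 by (simp add: image_subset_iff V_def ev_def restrict_PiE_iff)
  ultimately have "ev ` V = V" by blast
  then have inj: "inj_on ev V" using fin by (simp add: eq_card_imp_inj_on)
  have "ev (restrict s {..<p}) = ev (restrict t {..<p})"
    unfolding ev_def by (intro restrict_ext) (use eq in \<open>simp add: cong_def\<close>)
  moreover have "restrict s {..<p} \<in> V" "restrict t {..<p} \<in> V"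
    using assms(2,3) by (simp_all add: V_def restrict_PiE_iff)
  ultimately have "restrict s {..<p} = restrict t {..<p}" using inj by (blast dest: inj_onD)
  then show ?thesis using \<open>a < p\<close> by (metis lessThan_iff restrict_apply')
qed

subsection \<open>Roots of unity and the expansion of diagonal elements\<close>

text \<open>With natural exponents, equality of values is congruence of exponents modulo
  \<open>n\<close>. Powers of \<open>omega p\<close> take the form
  \<open>unit_root p k\<close>.\<close>

definition unit_root :: "nat \<Rightarrow> nat \<Rightarrow> complex" where
  "unit_root n k = exp (2 * pi * \<i> * of_nat k / of_nat n)"

lemma unit_root_0 [simp]: "unit_root n 0 = 1"
  by (simp add: unit_root_def)

lemma unit_root_nonzero [simp]: "unit_root n k \<noteq> 0"
  by (simp add: unit_root_def)

lemma unit_root_add: "unit_root n (j + k) = unit_root n j * unit_root n k"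
  by (simp add: unit_root_def ring_distribs add_divide_distrib exp_add)

lemma unit_root_power: "unit_root n k ^ j = unit_root n (j * k)"
  by (induction j) (auto simp: unit_root_add)

lemma unit_root_cancel: "0 < d \<Longrightarrow> unit_root (n * d) (k * d) = unit_root n k"
  by (simp add: unit_root_def mult.assoc)

lemma unit_root_cis: "unit_root n k = cis (2 * pi * real k / real n)"
  by (simp add: unit_root_def cis_conv_exp mult_ac)

lemma unit_root_mod: "0 < n \<Longrightarrow> unit_root n (k mod n) = unit_root n k"
proof -
  assume n: "0 < n"
  have "unit_root n (n * j) = 1" for j
    using n cis_multiple_2pi[of "real j"] by (simp add: unit_root_cis mult_ac)
  then have "unit_root n (n * (k div n) + k mod n) = unit_root n (k mod n)"
    by (simp only: unit_root_add) simp
  then show ?thesis by simp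
qed

lemma unit_root_eq_iff:
  assumes "0 < n"
  shows "unit_root n j = unit_root n k \<longleftrightarrow> [j = k] (mod n)"
proof -
  have "unit_root n (j mod n) = unit_root n (k mod n) \<longleftrightarrow> j mod n = k mod n"
    using bij_betw_imp_inj_on[OF bij_betw_roots_unity[OF assms]] assms
    unfolding unit_root_cis by (subst inj_on_eq_iff[where f = "\<lambda>k. cis (2 * pi * real k / real n)"]) auto
  then show ?thesis using assms by (simp add: unit_root_mod cong_def)
qed

lemma unit_root_eq_1_iff: "0 < n \<Longrightarrow> unit_root n j = 1 \<longleftrightarrow> n dvd j"
  using unit_root_eq_iff[of n j 0] by (simp add: cong_0_iff)

lemma root_of_unity_obtain:
  assumes "z ^ n = 1" "0 < n"
  obtains k where "k < n" "z = unit_root n k"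
proof -
  have "z \<in> (\<lambda>k. cis (2 * pi * real k / real n)) ` {..<n}"
    using bij_betw_imp_surj_on[OF bij_betw_roots_unity[OF assms(2)]] assms(1) by simp
  then show ?thesis using that by (auto simp: unit_root_cis)
qed

lemma omega_power: "omega p ^ k = unit_root p k"
  by (simp add: omega_def unit_root_def exp_of_nat_mult[symmetric] mult_ac)

text \<open>The exponential in the definition of \<open>theta\<close> as a product with one factor
  for each level \<open>j\<close>, which permits induction on \<open>m\<close>.\<close>

definition expansion :: "nat \<Rightarrow> nat \<Rightarrow> (nat \<Rightarrow> nat \<Rightarrow> nat) \<Rightarrow> nat \<Rightarrow> complex" where
  "expansion p m th q = (\<Prod>j\<in>{1..m}. unit_root (p ^ j) (\<Sum>a<p. th j a * q ^ a))"

lemma exp_expansion: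
  "exp (2 * pi * \<i> * (\<Sum>j\<in>{1..m}. (\<Sum>a<p. of_nat (th j a * q ^ a)) / of_nat (p ^ j)))
     = expansion p m th q"
  by (simp add: expansion_def unit_root_def sum_distrib_left exp_sum)

lemma expansion_0: "expansion p 0 th q = 1"
  by (simp add: expansion_def)

lemma expansion_Suc: "expansion p (Suc m) th q =
    expansion p m th q * unit_root (p ^ Suc m) (\<Sum>a<p. th (Suc m) a * q ^ a)"
  by (simp add: expansion_def)

lemma expansion_power:
  assumes "0 < p"
  shows "expansion p m th q ^ (p ^ m) = 1"
proof (induction m)
  case (Suc m)
  have "unit_root (p ^ Suc m) k ^ (p ^ Suc m) = 1" for k
    using assms by (simp only: unit_root_power) (simp add: unit_root_eq_1_iff)
  moreover have "expansion p m th q ^ (p ^ Suc m) = 1"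
    using Suc by (simp add: power_mult mult.commute[of p])
  ultimately show ?case by (simp only: expansion_Suc power_mult_distrib) simp
qed (simp add: expansion_0)

text \<open>The power \<open>p ^ m\<close> kills all levels up to \<open>m\<close> and turns the top
  level into a p-th root of unity. This isolates the top polynomial modulo \<open>p\<close>.\<close>

lemma expansion_Suc_power:
  assumes "0 < p"
  shows "expansion p (Suc m) th q ^ (p ^ m) = unit_root p (\<Sum>a<p. th (Suc m) a * q ^ a)"
proof -
  have "unit_root (p ^ Suc m) k ^ (p ^ m) = unit_root p k" for k
    using unit_root_cancel[of "p ^ m" p k] assms by (simp add: unit_root_power mult.commute)
  then show ?thesis
    using assms by (simp only: expansion_Suc power_mult_distrib) (simp add: expansion_power)
qed

text \<open>Levels are peeled off from the top: \<open>expansion_Suc_power\<close> determines the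
  values of the top polynomial modulo \<open>p\<close>, hence its coefficients, and the top factor
  then cancels.\<close>

lemma expansion_unique:
  assumes "prime p"
    and "\<And>j a. th j a < p" "\<And>j a. th' j a < p"
    and "\<And>q. q < p \<Longrightarrow> expansion p m th q = expansion p m th' q"
    and "1 \<le> j" "j \<le> m" "a < p"
  shows "th j a = th' j a"
  using assms(4-6)
proof (induction m)
  case (Suc m)
  have p0: "0 < p" using prime_gt_0_nat[OF assms(1)] .
  have top: "th (Suc m) a = th' (Suc m) a" if "a < p" for a
    using Suc.prems(1) p0
    by (intro interpolation_mod_prime_unique[OF assms(1) assms(2) assms(3) _ that])
      (metis expansion_Suc_power unit_root_eq_iff)
  have "expansion p m th q = expansion p m th' q" if "q < p" for q
    using Suc.prems(1)[OF that] top by (simp add: expansion_Suc)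
  then show ?case using Suc.IH Suc.prems top \<open>a < p\<close> by (cases "j = Suc m") auto
qed simp

lemma expansion_exists:
  assumes "prime p" and "\<And>q. q < p \<Longrightarrow> \<xi> q ^ (p ^ m) = 1"
  shows "\<exists>th. (\<forall>j a. th j a < p) \<and> (\<forall>j a. (j < 1 \<or> m < j \<or> p \<le> a) \<longrightarrow> th j a = 0) \<and>
    (\<forall>q<p. \<xi> q = expansion p m th q)"
  using assms(2)
proof (induction m arbitrary: \<xi>)
  case 0
  then show ?case
    using prime_gt_0_nat[OF assms(1)] by (intro exI[of _ "\<lambda>_ _. 0"]) (auto simp: expansion_0)
next
  case (Suc m)
  have p0: "0 < p" using prime_gt_0_nat[OF assms(1)] .
  have "\<exists>k. \<xi> q = unit_root (p ^ Suc m) k" if "q < p" for q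
    using root_of_unity_obtain[OF Suc.prems[OF that]] p0 by (metis zero_less_power)
  then obtain k where k: "\<And>q. q < p \<Longrightarrow> \<xi> q = unit_root (p ^ Suc m) (k q)" by metis
  obtain t where t: "\<And>a. t a < p" "\<And>a. p \<le> a \<Longrightarrow> t a = 0"
    "\<And>q. q < p \<Longrightarrow> [(\<Sum>a<p. t a * q ^ a) = k q] (mod p)"
    using interpolation_mod_prime[OF assms(1)] by metis
  \<comment> \<open>The factor of the top level. Since \<open>t\<close> agrees with \<open>k\<close>
    modulo \<open>p\<close>, the quotient of \<open>\<xi>\<close> by \<open>r\<close> has values
    whose \<open>p ^ m\<close>-th power is 1, as the induction hypothesis requires.\<close>
  define r where "r q = unit_root (p ^ Suc m) (\<Sum>a<p. t a * q ^ a)" for q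
  have low: "unit_root (p ^ Suc m) j ^ (p ^ m) = unit_root p j" for j
    using unit_root_cancel[of "p ^ m" p j] p0 by (simp add: unit_root_power mult.commute)
  have "(\<xi> q / r q) ^ (p ^ m) = 1" if "q < p" for q
    using t(3)[OF that] p0
    by (simp only: k[OF that] r_def power_divide low) (simp add: unit_root_eq_iff cong_sym)
  then obtain th where th: "\<And>j a. th j a < p"
    "\<And>j a. (j < 1 \<or> m < j \<or> p \<le> a) \<Longrightarrow> th j a = 0"
    "\<And>q. q < p \<Longrightarrow> \<xi> q / r q = expansion p m th q"
    using Suc.IH[of "\<lambda>q. \<xi> q / r q"] by metis
  define th' where "th' j = (if j = Suc m then t else th j)" for j
  have "expansion p m th' q = expansion p m th q" for q
    by (simp add: expansion_def th'_def)
  then have "\<forall>q<p. \<xi> q = expansion p (Suc m) th' q"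
    using th(3) by (auto simp: expansion_Suc r_def th'_def field_simps)
  moreover have "\<forall>j a. th' j a < p" "\<forall>j a. (j < 1 \<or> Suc m < j \<or> p \<le> a) \<longrightarrow> th' j a = 0"
    using th(1,2) t(1,2) by (auto simp: th'_def)
  ultimately show ?case by blast
qed

text \<open>The condition under the definite description in \<open>theta\<close>, with the
  exponential rewritten as \<open>expansion\<close>.\<close>

definition is_theta :: "nat \<Rightarrow> nat \<Rightarrow> (nat \<Rightarrow> complex) \<Rightarrow> (nat \<Rightarrow> nat \<Rightarrow> nat) \<Rightarrow> bool" where
  "is_theta p m \<xi> th \<longleftrightarrow> (\<forall>j a. th j a < p) \<and>
     (\<forall>j a. (j < 1 \<or> m < j \<or> p \<le> a) \<longrightarrow> th j a = 0) \<and> (\<forall>q<p. \<xi> q = expansion p m th q)"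

text \<open>Inside the index range coefficients are unique by \<open>expansion_unique\<close>,
  outside they are fixed to 0, so the whole function is unique. Values of \<open>Rfun\<close> and
  \<open>Pfun\<close> are computed below by exhibiting coefficients and applying this.\<close>

lemma theta_eqI:
  assumes "prime p" "is_theta p m \<xi> th"
  shows "theta p m \<xi> = th"
proof -
  have *: "th' = th" if "is_theta p m \<xi> th'" for th'
  proof (intro ext)
    fix j a
    show "th' j a = th j a"
    proof (cases "1 \<le> j \<and> j \<le> m \<and> a < p")
      case True
      then show ?thesis
        using expansion_unique[OF assms(1), of th' th m j a] that assms(2)
        unfolding is_theta_def by metis
    next
      case False
      then show ?thesis using that assms(2) unfolding is_theta_def by (metis not_le)
    qed
  qed
  then show ?thesis
    unfolding theta_def exp_expansion is_theta_def[symmetric] using * assms(2) by (intro the_equality)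
qed

lemma is_theta_theta:
  assumes "prime p" "\<And>q. q < p \<Longrightarrow> \<xi> q ^ (p ^ m) = 1"
  shows "is_theta p m \<xi> (theta p m \<xi>)"
proof -
  have "\<exists>th. is_theta p m \<xi> th"
    unfolding is_theta_def by (rule expansion_exists[OF assms])
  then show ?thesis using theta_eqI[OF assms(1)] by blast
qed

text \<open>\<open>Kdecomp\<close> picks some function representing the diagonal part, determined
  only below \<open>p\<close>; by this lemma the choice does not affect
  \<open>theta\<close>.\<close>

lemma theta_cong:
  assumes "\<And>q. q < p \<Longrightarrow> \<xi> q = \<eta> q"
  shows "theta p m \<xi> = theta p m \<eta>"
proof -
  have "is_theta p m \<xi> = is_theta p m \<eta>"
    using assms by (intro ext) (simp add: is_theta_def)
  then show ?thesis
    unfolding theta_def exp_expansion is_theta_def[symmetric] by simp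
qed

subsection \<open>Monomial matrices\<close>

text \<open>This is \<open>Smat p \<xi> * Xmat p ^\<^sub>m b\<close>, for any natural
  \<open>b\<close>. All computations with elements of \<open>K\<close> are done in this
  form.\<close>

definition mono_mat :: "nat \<Rightarrow> (nat \<Rightarrow> complex) \<Rightarrow> nat \<Rightarrow> complex mat" where
  "mono_mat p \<xi> b = mat p p (\<lambda>(i, j). if i = (j + b) mod p then \<xi> i else 0)"

lemma mono_mat_carrier [simp]: "mono_mat p \<xi> b \<in> carrier_mat p p"
  by (simp add: mono_mat_def)

lemma mono_mat_dim [simp]: "dim_row (mono_mat p \<xi> b) = p" "dim_col (mono_mat p \<xi> b) = p"
  by (simp_all add: mono_mat_def)

lemma mono_mat_cong:
  assumes "\<And>q. q < p \<Longrightarrow> \<xi> q = \<eta> q" "[b = c] (mod p)"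
  shows "mono_mat p \<xi> b = mono_mat p \<eta> c"
proof -
  have "(j + b) mod p = (j + c) mod p" for j
    using assms(2) by (metis cong_def mod_add_right_eq)
  then show ?thesis using assms(1) by (intro eq_matI) (auto simp: mono_mat_def)
qed

text \<open>\<open>(p - 1) * b\<close> is \<open>- b\<close> modulo \<open>p\<close> without leaving
  the natural numbers. The same device recurs throughout.\<close>

lemma mod_shift_back:
  fixes p b q r :: nat
  assumes "q < p" "r < p"
  shows "q = (r + b) mod p \<longleftrightarrow> r = (q + (p - 1) * b) mod p"
proof -
  obtain p' where p: "p = Suc p'" using assms by (cases p) auto
  have "(r + b + (p - 1) * b) mod p = r" "(q + (p - 1) * b + b) mod p = q"
    using assms mod_mult_self2[of r p b] mod_mult_self2[of q p b]
    by (simp_all add: p algebra_simps)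
  then show ?thesis by (metis mod_add_left_eq)
qed

text \<open>The position of the nonzero entry in column 0 gives the shift modulo \<open>p\<close>;
  the single entry of row \<open>q\<close> then gives the phase \<open>\<xi> q\<close>.\<close>

lemma mono_mat_eqD:
  assumes "0 < p" "mono_mat p \<xi> b = mono_mat p \<eta> c" "\<And>q. q < p \<Longrightarrow> \<xi> q \<noteq> 0"
  shows "[b = c] (mod p)" and "q < p \<Longrightarrow> \<xi> q = \<eta> q"
proof -
  have *: "(if i = (j + b) mod p then \<xi> i else 0) = (if i = (j + c) mod p then \<eta> i else 0)"
    if "i < p" "j < p" for i j
    using arg_cong[OF assms(2), of "\<lambda>M. M $$ (i, j)"] that by (simp add: mono_mat_def)
  show "[b = c] (mod p)"
    using *[of "b mod p" 0] assms(1,3) by (auto simp: cong_def split: if_splits)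
  show "\<xi> q = \<eta> q" if "q < p"
  proof -
    define j where "j = (q + (p - 1) * b) mod p"
    have "j < p" using assms(1) by (simp add: j_def)
    moreover have "q = (j + b) mod p" using mod_shift_back[OF that \<open>j < p\<close>] j_def by blast
    ultimately show ?thesis using *[OF that \<open>j < p\<close>] assms(3)[OF that] by (auto split: if_splits)
  qed
qed

text \<open>Moving the shift by \<open>b\<close> past the diagonal part \<open>\<eta>\<close>
  replaces its argument \<open>q\<close> by \<open>q - b\<close> modulo \<open>p\<close>.\<close>

lemma mono_mat_mult:
  assumes "0 < p"
  shows "mono_mat p \<xi> b * mono_mat p \<eta> c =
    mono_mat p (\<lambda>q. \<xi> q * \<eta> ((q + (p - 1) * b) mod p)) (b + c)"
proof (rule eq_matI)
  fix i j assume "i < dim_row (mono_mat p (\<lambda>q. \<xi> q * \<eta> ((q + (p - 1) * b) mod p)) (b + c))"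
    "j < dim_col (mono_mat p (\<lambda>q. \<xi> q * \<eta> ((q + (p - 1) * b) mod p)) (b + c))"
  then have i: "i < p" and j: "j < p" by simp_all
  define k where "k = (j + c) mod p"
  have k: "k < p" using assms by (simp add: k_def)
  have "(mono_mat p \<xi> b * mono_mat p \<eta> c) $$ (i, j)
      = (\<Sum>l\<in>{0..<p}. (if i = (l + b) mod p then \<xi> i else 0) * (if l = k then \<eta> l else 0))"
    using i j by (simp add: scalar_prod_def k_def mono_mat_def)
  also have "\<dots> = (\<Sum>l\<in>{0..<p}. if l = k then (if i = (l + b) mod p then \<xi> i else 0) * \<eta> l else 0)"
    by (intro sum.cong) auto
  also have "\<dots> = (if i = (k + b) mod p then \<xi> i else 0) * \<eta> k"
    using k by (simp add: sum.delta)
  also have "\<dots> = (if i = (k + b) mod p then \<xi> i * \<eta> ((i + (p - 1) * b) mod p) else 0)"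
    using mod_shift_back[OF i k, of b] by auto
  also have "(k + b) mod p = (j + (b + c)) mod p"
    by (simp add: k_def mod_simps add_ac)
  finally show "(mono_mat p \<xi> b * mono_mat p \<eta> c) $$ (i, j) =
      mono_mat p (\<lambda>q. \<xi> q * \<eta> ((q + (p - 1) * b) mod p)) (b + c) $$ (i, j)"
    using i j by (simp add: mono_mat_def)
qed simp_all

lemma one_mat_mono: "1\<^sub>m p = mono_mat p (\<lambda>_. 1) 0"
  by (intro eq_matI) (auto simp: mono_mat_def)

lemma mono_mat_power:
  assumes "0 < p"
  shows "mono_mat p \<xi> b ^\<^sub>m k =
    mono_mat p (\<lambda>q. \<Prod>i<k. \<xi> ((q + (p - 1) * b * i) mod p)) (k * b)"
proof (induction k)
  case 0
  show ?case by (simp add: one_mat_mono)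
next
  case (Suc k)
  show ?case
    by (simp add: Suc mono_mat_mult[OF assms])
      (intro mono_mat_cong, auto simp: mult_ac add_ac)
qed

lemma mono_mat_0_power: "0 < p \<Longrightarrow> mono_mat p \<xi> 0 ^\<^sub>m k = mono_mat p (\<lambda>q. \<xi> q ^ k) 0"
  by (simp add: mono_mat_power, intro mono_mat_cong) auto

text \<open>When \<open>b\<close> is invertible modulo \<open>p\<close>, the index
  \<open>q - b * i\<close> runs through all residues as \<open>i\<close> does, so each entry of the
  p-th power is the full product of the phases.\<close>

lemma mono_mat_power_p:
  assumes "prime p" "\<not> p dvd b"
  shows "mono_mat p \<xi> b ^\<^sub>m p = mono_mat p (\<lambda>_. \<Prod>q<p. \<xi> q) 0"
proof -
  have p: "1 < p" using prime_gt_1_nat[OF assms(1)] .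
  have "coprime (p - 1) p" using p coprime_diff_one_left_nat[of p] by simp
  then have cop: "coprime ((p - 1) * b) p"
    using prime_imp_coprime[OF assms] by (simp add: coprime_commute)
  have "(\<Prod>i<p. \<xi> ((q + (p - 1) * b * i) mod p)) = (\<Prod>q<p. \<xi> q)" if "q < p" for q
  proof -
    define h where "h i = (q + (p - 1) * b * i) mod p" for i
    have inj: "inj_on h {..<p}"
    proof (rule inj_onI)
      fix i j assume ij: "i \<in> {..<p}" "j \<in> {..<p}" "h i = h j"
      then have "[(p - 1) * b * i = (p - 1) * b * j] (mod p)"
        unfolding h_def cong_def[symmetric] by (simp add: cong_add_lcancel_nat)
      then have "[i = j] (mod p)" using cop cong_mult_lcancel_nat by blast
      then show "i = j" using ij by (simp add: cong_def)
    qed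
    have "h ` {..<p} = {..<p}"
      using p inj by (intro endo_inj_surj) (auto simp: h_def)
    then have "bij_betw h {..<p} {..<p}" using inj by (simp add: bij_betw_def)
    from prod.reindex_bij_betw[OF this, of \<xi>] show ?thesis by (simp add: h_def)
  qed
  then show ?thesis
    using p by (simp add: mono_mat_power) (intro mono_mat_cong, auto simp: cong_def)
qed

section \<open>The matrices and sets of the statement in monomial form\<close>

lemma Smat_mono: "Smat p \<xi> = mono_mat p \<xi> 0"
  by (intro eq_matI) (auto simp: Smat_def mono_mat_def)

lemma Xmat_mono: "Xmat p = mono_mat p (\<lambda>_. 1) 1"
  by (intro eq_matI) (auto simp: Xmat_def mono_mat_def)

lemma Smat_Xmat_power:
  assumes "0 < p"
  shows "Smat p \<xi> * Xmat p ^\<^sub>m b = mono_mat p \<xi> b"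
  using assms by (simp add: Smat_mono Xmat_mono mono_mat_power mono_mat_mult)

lemma Smat_Xmat: "0 < p \<Longrightarrow> Smat p \<xi> * Xmat p = mono_mat p \<xi> 1"
  by (simp add: Smat_mono Xmat_mono mono_mat_mult)

lemma inTpow_iff:
  assumes "0 < p"
  shows "inTpow p m \<xi> \<longleftrightarrow>
    (\<forall>q<p. cmod (\<xi> q) = 1) \<and> (\<Prod>q<p. \<xi> q) = 1 \<and> (\<forall>q<p. \<xi> q ^ (p ^ m) = 1)"
proof -
  have "mono_mat p (\<lambda>q. \<xi> q ^ p ^ m) 0 = 1\<^sub>m p \<longleftrightarrow> (\<forall>q<p. \<xi> q ^ (p ^ m) = 1)"
  proof
    assume "mono_mat p (\<lambda>q. \<xi> q ^ p ^ m) 0 = 1\<^sub>m p"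
    then have "mono_mat p (\<lambda>_. 1) 0 = mono_mat p (\<lambda>q. \<xi> q ^ p ^ m) 0"
      by (simp add: one_mat_mono)
    from mono_mat_eqD(2)[OF assms this] show "\<forall>q<p. \<xi> q ^ (p ^ m) = 1" by fastforce
  next
    assume "\<forall>q<p. \<xi> q ^ (p ^ m) = 1"
    then show "mono_mat p (\<lambda>q. \<xi> q ^ p ^ m) 0 = 1\<^sub>m p"
      unfolding one_mat_mono by (intro mono_mat_cong) auto
  qed
  then show ?thesis
    by (simp add: inTpow_def inT_def Smat_mono mono_mat_0_power[OF assms])
qed

lemma inTpow_nonzero: "0 < p \<Longrightarrow> inTpow p m \<xi> \<Longrightarrow> q < p \<Longrightarrow> \<xi> q \<noteq> 0"
  by (auto simp: inTpow_iff)

lemma prod_mod_shift: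
  fixes f :: "nat \<Rightarrow> complex"
  assumes "0 < p"
  shows "(\<Prod>q<p. f ((q + c) mod p)) = (\<Prod>q<p. f q)"
proof -
  have inj: "inj_on (\<lambda>q. (q + c) mod p) {..<p}"
    by (intro inj_onI) (metis cong_add_rcancel_nat cong_def lessThan_iff mod_less)
  have "(\<lambda>q. (q + c) mod p) ` {..<p} = {..<p}"
    using assms inj by (intro endo_inj_surj) auto
  then have "bij_betw (\<lambda>q. (q + c) mod p) {..<p} {..<p}" using inj by (simp add: bij_betw_def)
  from prod.reindex_bij_betw[OF this, of f] show ?thesis .
qed

lemma inTpow_mult_shift:
  assumes "0 < p" "inTpow p m \<xi>" "inTpow p m \<eta>"
  shows "inTpow p m (\<lambda>q. \<xi> q * \<eta> ((q + c) mod p))"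
  using assms by (simp add: inTpow_iff prod.distrib prod_mod_shift norm_mult power_mult_distrib)

lemma inTpow_one: "0 < p \<Longrightarrow> inTpow p m (\<lambda>_. 1)"
  by (simp add: inTpow_iff)

text \<open>Unlike in \<^const>\<open>Kset\<close>, the shift need not be reduced modulo \<open>p\<close>, so shifts simply add.\<close>

definition K_shift :: "nat \<Rightarrow> nat \<Rightarrow> nat \<Rightarrow> complex mat set" where
  "K_shift p m b = {mono_mat p \<xi> b | \<xi>. inTpow p m \<xi>}"

lemma K_shift_carrier: "A \<in> K_shift p m b \<Longrightarrow> A \<in> carrier_mat p p"
  by (auto simp: K_shift_def)

lemma K_shift_mult:
  assumes "0 < p" "A \<in> K_shift p m b" "B \<in> K_shift p m c"
  shows "A * B \<in> K_shift p m (b + c)"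
  using assms inTpow_mult_shift[OF assms(1)] by (auto simp: K_shift_def mono_mat_mult)

lemma K_shift_power:
  assumes "0 < p" "A \<in> K_shift p m b"
  shows "A ^\<^sub>m k \<in> K_shift p m (k * b)"
proof (induction k)
  case 0
  then show ?case
    using assms inTpow_one[OF assms(1)] by (auto simp: K_shift_def one_mat_mono)
next
  case (Suc k)
  then show ?case using K_shift_mult[OF assms(1) Suc assms(2)] by (simp add: add.commute)
qed

text \<open>The determinant condition makes the product of all phases 1, so nondiagonal elements
  have p-th power one automatically.\<close>

lemma K_shift_power_p:
  assumes "prime p" "\<not> p dvd b" "A \<in> K_shift p m b"
  shows "A ^\<^sub>m p = 1\<^sub>m p"
  using assms prime_gt_0_nat[OF assms(1)]
  by (auto simp: K_shift_def mono_mat_power_p inTpow_iff one_mat_mono)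

lemma K_shift_cong: "[b = c] (mod p) \<Longrightarrow> K_shift p m b = K_shift p m c"
proof -
  assume "[b = c] (mod p)"
  then have "mono_mat p \<xi> b = mono_mat p \<xi> c" for \<xi> by (intro mono_mat_cong) auto
  then show ?thesis by (simp add: K_shift_def)
qed

lemma Kset_eq: "0 < p \<Longrightarrow> Kset p m = (\<Union>b\<in>{..<p}. K_shift p m b)"
  by (auto simp: Kset_def K_shift_def Smat_Xmat_power)

section \<open>Powers of square matrices\<close>

lemma pow_mat_add:
  fixes A :: "'a :: semiring_1 mat"
  assumes "A \<in> carrier_mat n n"
  shows "A ^\<^sub>m (j + k) = A ^\<^sub>m j * A ^\<^sub>m k"
proof (induction k)
  case (Suc k)
  then show ?case
    using assms assoc_mult_mat[OF pow_carrier_mat[OF assms] pow_carrier_mat[OF assms] assms] by simp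
qed (use assms in auto)

lemma one_pow_mat [simp]: "(1\<^sub>m n :: 'a :: semiring_1 mat) ^\<^sub>m k = 1\<^sub>m n"
  by (induction k) auto

lemma pow_mat_mult:
  fixes A :: "'a :: semiring_1 mat"
  assumes "A \<in> carrier_mat n n"
  shows "A ^\<^sub>m (j * k) = (A ^\<^sub>m j) ^\<^sub>m k"
proof (induction k)
  case (Suc k)
  then show ?case using pow_mat_add[OF assms, of "j * k" j] by (simp add: add.commute)
qed (use assms in auto)

lemma pow_mat_1: "A \<in> carrier_mat n n \<Longrightarrow> (A :: 'a :: semiring_1 mat) ^\<^sub>m 1 = A"
  by simp

lemma pow_mat_mod:
  fixes A :: "'a :: semiring_1 mat"
  assumes "A \<in> carrier_mat n n" "A ^\<^sub>m p = 1\<^sub>m n" "[j = k] (mod p)"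
  shows "A ^\<^sub>m j = A ^\<^sub>m k"
proof -
  have "A ^\<^sub>m i = A ^\<^sub>m (i mod p)" for i
  proof -
    have "A ^\<^sub>m i = A ^\<^sub>m (p * (i div p) + i mod p)" by simp
    also have "\<dots> = A ^\<^sub>m (i mod p)"
      using assms(1) pow_carrier_mat[OF assms(1), of "i mod p"]
      by (simp only: pow_mat_add[OF assms(1)] pow_mat_mult[OF assms(1)] assms(2)) simp
    finally show ?thesis .
  qed
  then show ?thesis using assms(3) by (metis cong_def)
qed

subsection \<open>The map on a single tensor factor\<close>

text \<open>The matrix determines the phases below \<open>p\<close> and the shift modulo
  \<open>p\<close>; as both shifts are less than \<open>p\<close>, the chosen one is exactly
  \<open>b\<close>.\<close>

lemma Kdecomp_mono_mat:
  assumes "0 < p" "inTpow p m \<xi>" "b < p"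
  obtains \<eta> where "Kdecomp p m (mono_mat p \<xi> b) = (\<eta>, b)" "\<And>q. q < p \<Longrightarrow> \<eta> q = \<xi> q"
proof -
  let ?M = "mono_mat p \<xi> b"
  obtain \<eta> c where d: "Kdecomp p m ?M = (\<eta>, c)" by (cases "Kdecomp p m ?M")
  have "(case Kdecomp p m ?M of (\<eta>, c) \<Rightarrow> inTpow p m \<eta> \<and> c < p \<and> ?M = Smat p \<eta> * Xmat p ^\<^sub>m c)"
    unfolding Kdecomp_def
    by (rule someI[of _ "(\<xi>, b)"]) (use assms in \<open>simp add: Smat_Xmat_power\<close>)
  then have "c < p" "?M = mono_mat p \<eta> c" using assms by (auto simp: d Smat_Xmat_power)
  then have "c = b" "\<And>q. q < p \<Longrightarrow> \<eta> q = \<xi> q"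
    using mono_mat_eqD[OF assms(1) \<open>?M = mono_mat p \<eta> c\<close>] inTpow_nonzero[OF assms(1,2)] assms(3)
    by (auto simp: cong_def)
  then show ?thesis using d that by blast
qed

lemma phi1_shift_0:
  assumes "0 < p" "inTpow p m \<xi>"
  shows "phi1 p m (mono_mat p \<xi> 0) = mono_mat p (Rfun p m \<xi>) 0"
proof -
  obtain \<eta> where \<eta>: "Kdecomp p m (mono_mat p \<xi> 0) = (\<eta>, 0)" "\<And>q. q < p \<Longrightarrow> \<eta> q = \<xi> q"
    using Kdecomp_mono_mat[OF assms assms(1)] by metis
  have "Rfun p m \<eta> = Rfun p m \<xi>"
    using theta_cong[OF \<eta>(2)] by (simp add: Rfun_def fun_eq_iff)
  then show ?thesis by (simp add: phi1_def phi1_base_def \<eta>(1) Smat_mono)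
qed

lemma phi1_base_shift_1:
  assumes "1 < p" "inTpow p m \<xi>"
  shows "phi1_base p m (mono_mat p \<xi> 1) = mono_mat p (Pfun p m \<xi>) 1"
proof -
  have p0: "0 < p" using assms(1) by simp
  obtain \<eta> where \<eta>: "Kdecomp p m (mono_mat p \<xi> 1) = (\<eta>, 1)" "\<And>q. q < p \<Longrightarrow> \<eta> q = \<xi> q"
    using Kdecomp_mono_mat[OF p0 assms(2,1)] by metis
  have "Pfun p m \<eta> = Pfun p m \<xi>"
    using theta_cong[OF \<eta>(2)] by (simp add: Pfun_def fun_eq_iff)
  then show ?thesis using p0 by (simp add: phi1_base_def \<eta>(1)[simplified] Smat_Xmat)
qed

lemma phi1_shift_1:
  assumes "1 < p" "inTpow p m \<xi>"
  shows "phi1 p m (mono_mat p \<xi> 1) = mono_mat p (Pfun p m \<xi>) 1"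
proof -
  have p0: "0 < p" using assms(1) by simp
  obtain \<eta> where "Kdecomp p m (mono_mat p \<xi> 1) = (\<eta>, 1)"
    using Kdecomp_mono_mat[OF p0 assms(2,1)] by metis
  then show ?thesis using phi1_base_shift_1[OF assms] by (simp add: phi1_def Let_def)
qed

text \<open>For \<open>k > 1\<close> the definition of \<open>phi1\<close> raises
  \<open>N ^\<^sub>m k\<close> to the inverse of \<open>k\<close> modulo \<open>p\<close>. This
  gives back \<open>N\<close>, because \<open>N\<close> has p-th power one.\<close>

lemma phi1_power:
  assumes "prime p" "N \<in> K_shift p m 1" "0 < k" "k < p"
  shows "phi1 p m (N ^\<^sub>m k) = phi1 p m N ^\<^sub>m k"
proof (cases "k = 1")
  case True
  obtain \<xi> where "N = mono_mat p \<xi> 1" "inTpow p m \<xi>" using assms(2) by (auto simp: K_shift_def)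
  then have "phi1 p m N \<in> carrier_mat p p"
    using phi1_shift_1[OF prime_gt_1_nat[OF assms(1)]] by simp
  then show ?thesis using True pow_mat_1 K_shift_carrier[OF assms(2)] by metis
next
  case False
  have p: "1 < p" "0 < p" using prime_gt_1_nat[OF assms(1)] by auto
  obtain \<zeta> where \<zeta>: "N = mono_mat p \<zeta> 1" "inTpow p m \<zeta>" using assms(2) by (auto simp: K_shift_def)
  have "N ^\<^sub>m k \<in> K_shift p m k" using K_shift_power[OF p(2) assms(2), of k] by simp
  then obtain \<xi> where \<xi>: "N ^\<^sub>m k = mono_mat p \<xi> k" "inTpow p m \<xi>" by (auto simp: K_shift_def)
  obtain \<eta> where \<eta>: "Kdecomp p m (N ^\<^sub>m k) = (\<eta>, k)"
    using Kdecomp_mono_mat[OF p(2) \<xi>(2) assms(4)] \<xi>(1) by metis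
  define y where "y = (SOME y. y < p \<and> [y * k = 1] (mod p))"
  have "coprime k p"
    using assms prime_imp_coprime[OF assms(1), of k] by (auto simp: coprime_commute dest: nat_dvd_not_less)
  \<comment> \<open>The choice of \<open>y\<close> needs an admissible value to exist;
    \<open>z mod p\<close> is one.\<close>
  then obtain z where "[k * z = 1] (mod p)" using cong_solve_coprime_nat by auto
  then have "z mod p < p \<and> [z mod p * k = 1] (mod p)"
    using p by (simp add: cong_def mult.commute mod_mult_right_eq)
  then have y: "[k * y = 1] (mod p)"
    unfolding y_def by (rule someI2) (simp add: mult.commute)
  have "(N ^\<^sub>m k) ^\<^sub>m y = N"
    using pow_mat_mod[OF K_shift_carrier[OF assms(2)] K_shift_power_p[OF assms(1) _ assms(2)] y]
      K_shift_carrier[OF assms(2)] p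
    by (simp add: pow_mat_mult[OF K_shift_carrier[OF assms(2)]])
  moreover have "phi1 p m (N ^\<^sub>m k) = phi1_base p m ((N ^\<^sub>m k) ^\<^sub>m y) ^\<^sub>m k"
    using assms(3) False by (simp add: phi1_def \<eta> Let_def y_def)
  ultimately show ?thesis
    using phi1_base_shift_1[OF p(1) \<zeta>(2)] phi1_shift_1[OF p(1) \<zeta>(2)] by (simp add: \<zeta>(1))
qed

section \<open>Values of \<open>R\<close> and \<open>P\<close>\<close>

lemma unit_root_cong: "0 < n \<Longrightarrow> [j = k] (mod n) \<Longrightarrow> unit_root n j = unit_root n k"
  by (simp add: unit_root_eq_iff)

lemma unit_root_sum: "(\<Prod>x\<in>A. unit_root n (f x)) = unit_root n (\<Sum>x\<in>A. f x)"
  by (induction A rule: infinite_finite_induct) (auto simp: unit_root_add)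

lemma sum_linear_coeffs:
  fixes a c q :: nat
  assumes "1 < p"
  shows "(\<Sum>x<p. ((if x = 0 then a else 0) + (if x = 1 then c else 0)) * q ^ x) = a + c * q"
proof -
  have "(\<Sum>x<p. ((if x = 0 then a else 0) + (if x = 1 then c else 0)) * q ^ x)
      = (\<Sum>x<p. if x = 0 then a else 0) + (\<Sum>x<p. if x = 1 then c * q else 0)"
    unfolding sum.distrib[symmetric] by (intro sum.cong) auto
  then show ?thesis using assms by simp
qed

lemma sum_add_linear_coeffs:
  fixes a c q :: nat
  assumes "1 < p"
  shows "(\<Sum>x<p. (t x + ((if x = 0 then a else 0) + (if x = 1 then c else 0))) * q ^ x)
    = (\<Sum>x<p. t x * q ^ x) + (a + c * q)"
  using sum_linear_coeffs[OF assms, of a c q] by (simp add: distrib_right sum.distrib add.assoc)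

lemma cong_sum_coeffs_mod:
  fixes u :: "nat \<Rightarrow> nat"
  shows "[(\<Sum>x<p. (u x mod p) * q ^ x) = (\<Sum>x<p. u x * q ^ x)] (mod p)"
  by (intro cong_sum cong_mult cong_refl) (simp add: cong_def)

text \<open>Writing \<open>s\<close> as \<open>(s div p) * p + s mod p\<close> yields the expansion:
  the carry \<open>s div p\<close> joins the constant coefficient of level 1, and
  \<open>s mod p\<close> is the constant coefficient of level 2. If \<open>m = 1\<close> there is no
  level 2, and then \<open>p dvd s\<close> makes that coefficient 0. \<open>R\<close> thus drops
  only the part of \<open>t\<close> in degrees two and above.\<close>

lemma Rfun_eq:
  assumes "prime p" "1 \<le> m" "2 \<le> m \<or> p dvd s"
    and \<xi>: "\<And>q. q < p \<Longrightarrow> \<xi> q = unit_root (p ^ 2) s * unit_root p (\<Sum>x<p. t x * q ^ x)"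
  shows "Rfun p m \<xi> q = unit_root (p ^ 2) s * unit_root p (t 0 + t 1 * q)"
proof -
  have p: "1 < p" "0 < p" using prime_gt_1_nat[OF assms(1)] by auto
  \<comment> \<open>The zero term in degree 1 gives \<open>u\<close> the shape of
    \<open>sum_add_linear_coeffs\<close> with slope 0.\<close>
  define u where "u x = t x + ((if x = 0 then s div p else 0) + (if x = 1 then 0 else 0))" for x :: nat
  define th where "th j x = (if j = 1 \<and> x < p then u x mod p
      else if j = 2 \<and> x = 0 \<and> 2 \<le> m then s mod p else 0)" for j x :: nat
  have carry: "unit_root (p ^ 2) s = unit_root p (s div p) * unit_root (p ^ 2) (s mod p)"
  proof -
    have "unit_root (p ^ 2) s = unit_root (p ^ 2) (s div p * p + s mod p)" by simp
    also have "\<dots> = unit_root (p * p) (s div p * p) * unit_root (p ^ 2) (s mod p)"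
      by (simp only: unit_root_add power2_eq_square)
    finally show ?thesis using p by (simp only: unit_root_cancel)
  qed
  have e2: "unit_root (p ^ 2) (th 2 0) = unit_root (p ^ 2) (s mod p)"
    using assms(2,3) by (auto simp: th_def)
  have "is_theta p m \<xi> th"
    unfolding is_theta_def
  proof (intro conjI allI impI)
    fix j x show "th j x < p" using p by (simp add: th_def)
    show "th j x = 0" if "j < 1 \<or> m < j \<or> p \<le> x" using that p assms(2) by (auto simp: th_def)
  next
    fix q assume q: "q < p"
    have j1: "unit_root p (\<Sum>x<p. th 1 x * q ^ x)
        = unit_root p (s div p) * unit_root p (\<Sum>x<p. t x * q ^ x)"
    proof -
      have "(\<Sum>x<p. th 1 x * q ^ x) = (\<Sum>x<p. (u x mod p) * q ^ x)"
        by (simp add: th_def)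
      moreover have "(\<Sum>x<p. u x * q ^ x) = (\<Sum>x<p. t x * q ^ x) + (s div p + 0 * q)"
        unfolding u_def by (rule sum_add_linear_coeffs[OF p(1)])
      ultimately show ?thesis
        using unit_root_cong[OF p(2) cong_sum_coeffs_mod[of u p q]] by (simp add: unit_root_add)
    qed
    have rest: "unit_root (p ^ j) (\<Sum>x<p. th j x * q ^ x) = (if j = 2 then unit_root (p ^ 2) (th 2 0) else 1)"
      if "j \<noteq> 1" for j
    proof (cases "j = 2")
      case True
      have "(\<Sum>x<p. th 2 x * q ^ x) = (\<Sum>x<p. if x = 0 then th 2 0 else 0)"
        by (intro sum.cong) (auto simp: th_def)
      then show ?thesis using True p by simp
    next
      case False
      then show ?thesis using that by (simp add: th_def)
    qed
    have "expansion p m th q = unit_root p (\<Sum>x<p. th 1 x * q ^ x) *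
        (\<Prod>j\<in>{2..m}. unit_root (p ^ j) (\<Sum>x<p. th j x * q ^ x))"
      using assms(2) by (simp add: expansion_def prod.atLeast_Suc_atMost numeral_2_eq_2)
    also have "(\<Prod>j\<in>{2..m}. unit_root (p ^ j) (\<Sum>x<p. th j x * q ^ x))
        = (\<Prod>j\<in>{2..m}. if j = 2 then unit_root (p ^ 2) (th 2 0) else 1)"
      by (intro prod.cong refl rest) auto
    also have "\<dots> = unit_root (p ^ 2) (th 2 0)"
      using assms(2) by (auto simp: prod.delta th_def)
    finally show "\<xi> q = expansion p m th q"
      using \<xi>[OF q] by (simp only: j1 carry e2) (simp add: mult_ac)
  qed
  then have "theta p m \<xi> = th" by (rule theta_eqI[OF assms(1)])
  then have "Rfun p m \<xi> q = unit_root p (th 1 0 + th 1 1 * q) * unit_root (p ^ 2) (th 2 0)"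
    by (simp add: Rfun_def omega_power unit_root_def)
  also have "unit_root p (th 1 0 + th 1 1 * q) = unit_root p (s div p + (t 0 + t 1 * q))"
  proof (rule unit_root_cong[OF p(2)])
    have "[th 1 0 = t 0 + s div p] (mod p)" "[th 1 1 = t 1] (mod p)"
      using p by (simp_all add: th_def u_def cong_def)
    then have "[th 1 0 + th 1 1 * q = t 0 + s div p + t 1 * q] (mod p)"
      by (intro cong_add cong_mult cong_refl)
    then show "[th 1 0 + th 1 1 * q = s div p + (t 0 + t 1 * q)] (mod p)" by (simp add: add_ac)
  qed
  finally show ?thesis unfolding carry e2 by (simp add: unit_root_add mult_ac)
qed

text \<open>The phases of the diagonal Heisenberg-Weyl elements: \<open>omega p ^ a\<close> times
  the \<open>c\<close>-th power of \<open>Zmat p\<close>.\<close>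

definition lin :: "nat \<Rightarrow> nat \<Rightarrow> nat \<Rightarrow> nat \<Rightarrow> complex" where
  "lin p a c q = unit_root p (a + c * q)"

lemma Pfun_eq_lin: "Pfun p m \<xi> = lin p (theta p m \<xi> 1 0) (theta p m \<xi> 1 1)"
  by (simp add: Pfun_def lin_def omega_power fun_eq_iff)

text \<open>Only the constant and the linear coefficient of level 1 change, and these are what
  \<open>P\<close> keeps. Reducing them modulo \<open>p\<close> causes no carry, since level 1
  consists of p-th roots of unity.\<close>

lemma Pfun_lin_mult:
  assumes "prime p" "1 \<le> m" "\<And>q. q < p \<Longrightarrow> \<xi> q ^ (p ^ m) = 1"
  shows "Pfun p m (\<lambda>q. lin p a c q * \<xi> q) q = lin p a c q * Pfun p m \<xi> q"
proof -
  have p: "1 < p" "0 < p" using prime_gt_1_nat[OF assms(1)] by auto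
  define th where "th = theta p m \<xi>"
  have is_th: "is_theta p m \<xi> th"
    unfolding th_def using assms(3) by (rule is_theta_theta[OF assms(1)])
  have th: "th j x < p" "j < 1 \<or> m < j \<or> p \<le> x \<Longrightarrow> th j x = 0" "q < p \<Longrightarrow> \<xi> q = expansion p m th q"
    for j x q
    using is_th by (auto simp: is_theta_def)
  define u where "u x = th 1 x + ((if x = 0 then a else 0) + (if x = 1 then c else 0))" for x
  define th' where "th' j x = (if j = 1 then u x mod p else th j x)" for j x
  have "is_theta p m (\<lambda>q. lin p a c q * \<xi> q) th'"
    unfolding is_theta_def
  proof (intro conjI allI impI)
    fix j x show "th' j x < p" using p th(1) by (simp add: th'_def)
    show "th' j x = 0" if "j < 1 \<or> m < j \<or> p \<le> x"
      using that p assms(2) th(2)[of j x] by (auto simp: th'_def u_def)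
  next
    fix q assume q: "q < p"
    have "(\<Sum>x<p. u x * q ^ x) = (\<Sum>x<p. th 1 x * q ^ x) + (a + c * q)"
      unfolding u_def by (rule sum_add_linear_coeffs[OF p(1)])
    then have j1: "unit_root p (\<Sum>x<p. th' 1 x * q ^ x) = lin p a c q * unit_root p (\<Sum>x<p. th 1 x * q ^ x)"
      using unit_root_cong[OF p(2) cong_sum_coeffs_mod[of u p q]]
      by (simp add: th'_def unit_root_add lin_def)
    have split: "expansion p m f q = unit_root p (\<Sum>x<p. f 1 x * q ^ x) *
        (\<Prod>j\<in>{2..m}. unit_root (p ^ j) (\<Sum>x<p. f j x * q ^ x))" for f
      using assms(2) by (simp add: expansion_def prod.atLeast_Suc_atMost numeral_2_eq_2)
    have "(\<Prod>j\<in>{2..m}. unit_root (p ^ j) (\<Sum>x<p. th' j x * q ^ x))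
        = (\<Prod>j\<in>{2..m}. unit_root (p ^ j) (\<Sum>x<p. th j x * q ^ x))"
      by (intro prod.cong) (auto simp: th'_def)
    then show "lin p a c q * \<xi> q = expansion p m th' q"
      by (simp only: th(3)[OF q] split j1 mult.assoc)
  qed
  then have th'_eq: "theta p m (\<lambda>q. lin p a c q * \<xi> q) = th'" by (rule theta_eqI[OF assms(1)])
  have "[th' 1 0 = th 1 0 + a] (mod p)" "[th' 1 1 = th 1 1 + c] (mod p)"
    by (simp_all add: th'_def u_def cong_def)
  then have "[th' 1 0 + th' 1 1 * q = (th 1 0 + a) + (th 1 1 + c) * q] (mod p)"
    by (intro cong_add cong_mult cong_refl)
  then have "unit_root p (th' 1 0 + th' 1 1 * q) = unit_root p ((a + c * q) + (th 1 0 + th 1 1 * q))"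
    by (intro unit_root_cong[OF p(2)]) (simp add: algebra_simps)
  then show ?thesis
    unfolding Pfun_eq_lin th'_eq th_def[symmetric] unfolding lin_def by (simp add: unit_root_add)
qed

lemma sum_below_odd_dvd:
  fixes p :: nat
  assumes "odd p"
  shows "p dvd (\<Sum>q<p. q)"
proof -
  obtain k where k: "p = 2 * k + 1" using assms by (rule oddE)
  have "(\<Sum>q<2 * k + 1. q) = (2 * k + 1) * k"
    by (induction k) simp_all
  then show ?thesis unfolding k by (metis dvd_triv_left)
qed

text \<open>The exponents sum to \<open>p * a + c * (p * (p - 1) / 2)\<close>, a multiple of
  \<open>p\<close> because \<open>p\<close> is odd. Oddness is what places these phases in
  \<open>T\<close>.\<close>

lemma prod_lin:
  assumes "odd p"
  shows "(\<Prod>q<p. lin p a c q) = 1"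
proof -
  have "(\<Sum>q<p. a + c * q) = p * a + c * (\<Sum>q<p. q)"
    by (simp add: sum.distrib sum_distrib_left)
  then have "p dvd (\<Sum>q<p. a + c * q)" using sum_below_odd_dvd[OF assms] by simp
  then show ?thesis using assms by (simp add: lin_def unit_root_sum unit_root_eq_1_iff odd_pos)
qed

lemma inTpow_lin:
  assumes "odd p" "1 \<le> m"
  shows "inTpow p m (lin p a c)"
proof -
  have p: "0 < p" using assms(1) by (rule odd_pos)
  have "p dvd p ^ m * k" for k using assms(2) by simp
  then have "lin p a c q ^ p ^ m = 1" "cmod (lin p a c q) = 1" for q
    using p by (simp_all add: lin_def unit_root_power unit_root_eq_1_iff) (simp add: unit_root_cis)
  then show ?thesis
    using prod_lin[OF assms(1)] by (simp add: inTpow_iff[OF p])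
qed

section \<open>Diagonal matrices with linear exponents\<close>

lemma sq_mat_mult_carrier:
  "A \<in> carrier_mat n n \<Longrightarrow> B \<in> carrier_mat n n \<Longrightarrow> A * B \<in> carrier_mat n n"
  by (rule mult_carrier_mat)

lemma sq_mat_assoc:
  fixes A :: "'a :: semiring_0 mat"
  shows "A \<in> carrier_mat n n \<Longrightarrow> B \<in> carrier_mat n n \<Longrightarrow> C \<in> carrier_mat n n
    \<Longrightarrow> A * B * C = A * (B * C)"
  by (rule assoc_mult_mat)

definition Lmat :: "nat \<Rightarrow> nat \<Rightarrow> nat \<Rightarrow> complex mat" where
  "Lmat p a c = mono_mat p (lin p a c) 0"

lemma Lmat_carrier [simp]: "Lmat p a c \<in> carrier_mat p p"
  by (simp add: Lmat_def)

lemma Lmat_dim [simp]: "dim_row (Lmat p a c) = p" "dim_col (Lmat p a c) = p"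
  by (simp_all add: Lmat_def)

lemma Lmat_K_shift: "odd p \<Longrightarrow> 1 \<le> m \<Longrightarrow> Lmat p a c \<in> K_shift p m 0"
  using inTpow_lin by (auto simp: Lmat_def K_shift_def)

lemma Lmat_0: "Lmat p 0 0 = 1\<^sub>m p"
  unfolding Lmat_def one_mat_mono by (intro mono_mat_cong) (auto simp: lin_def)

lemma Lmat_cong:
  assumes "0 < p" "[a = a'] (mod p)" "[c = c'] (mod p)"
  shows "Lmat p a c = Lmat p a' c'"
  unfolding Lmat_def lin_def
  by (intro mono_mat_cong unit_root_cong[OF assms(1)] cong_add cong_mult assms cong_refl)

lemma Lmat_mult: "0 < p \<Longrightarrow> Lmat p a c * Lmat p a' c' = Lmat p (a + a') (c + c')"
  unfolding Lmat_def
  by (simp add: mono_mat_mult) (intro mono_mat_cong, auto simp: lin_def algebra_simps simp flip: unit_root_add)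

text \<open>Replacing \<open>q\<close> by \<open>q - b\<close> in a linear exponent alters only its
  constant term, so these matrices commute with every monomial matrix up to a scalar that depends on
  the shift alone.\<close>

lemma mono_mat_Lmat:
  assumes "0 < p"
  shows "mono_mat p \<xi> b * Lmat p a c = Lmat p (a + (p - 1) * b * c) c * mono_mat p \<xi> b"
proof -
  have "lin p a c ((q + (p - 1) * b) mod p) = lin p (a + (p - 1) * b * c) c q" for q
  proof -
    have "[a + c * ((q + (p - 1) * b) mod p) = a + c * (q + (p - 1) * b)] (mod p)"
      by (intro cong_add cong_mult cong_refl) (simp add: cong_def)
    then show ?thesis
      unfolding lin_def by (intro unit_root_cong[OF assms]) (simp add: algebra_simps)
  qed
  then show ?thesis
    using assms by (simp add: Lmat_def mono_mat_mult) (intro mono_mat_cong, auto)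
qed

lemma Lmat_mono_mat: "0 < p \<Longrightarrow> Lmat p a c * mono_mat p \<xi> b = mono_mat p (\<lambda>q. lin p a c q * \<xi> q) b"
  unfolding Lmat_def by (simp add: mono_mat_mult) (intro mono_mat_cong, auto)

text \<open>The correction \<open>e\<close> collects the phases from moving the diagonal factors to the left. It depends
  on the shift of \<open>M\<close> only, so it is the same for \<open>N\<close> and for its image under \<^const>\<open>phi1\<close>.\<close>

lemma Lmat_mult_power:
  assumes "0 < p"
  shows "\<exists>e. \<forall>a \<xi>. (Lmat p a c * mono_mat p \<xi> 1) ^\<^sub>m k
    = Lmat p (k * a + e) (k * c) * mono_mat p \<xi> 1 ^\<^sub>m k"
proof (induction k)
  case 0
  show ?case by (intro exI[of _ 0]) (simp add: Lmat_0)
next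
  case (Suc k)
  then obtain e where e: "\<And>a \<xi>. (Lmat p a c * mono_mat p \<xi> 1) ^\<^sub>m k
      = Lmat p (k * a + e) (k * c) * mono_mat p \<xi> 1 ^\<^sub>m k" by blast
  show ?case
  proof (intro exI allI)
    fix a \<xi>
    define M where "M = mono_mat p \<xi> 1"
    have c: "M ^\<^sub>m k \<in> carrier_mat p p" "M \<in> carrier_mat p p" by (simp_all add: M_def)
    \<comment> \<open>Only the shift \<open>k\<close> of this power matters for the exchange; the
      phases \<open>\<zeta>\<close> do not enter the new correction
      \<open>e + (p - 1) * k * c\<close>.\<close>
    obtain \<zeta> where \<zeta>: "M ^\<^sub>m k = mono_mat p \<zeta> k" using assms unfolding M_def by (simp add: mono_mat_power)
    note assoc = sq_mat_assoc[where n = p]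
    have "(Lmat p a c * M) ^\<^sub>m Suc k = (Lmat p (k * a + e) (k * c) * M ^\<^sub>m k) * (Lmat p a c * M)"
      unfolding M_def by (simp only: pow_mat.simps e)
    also have "\<dots> = Lmat p (k * a + e) (k * c) * (M ^\<^sub>m k * Lmat p a c) * M"
      by (simp only: assoc c Lmat_carrier sq_mat_mult_carrier)
    also have "M ^\<^sub>m k * Lmat p a c = Lmat p (a + (p - 1) * k * c) c * M ^\<^sub>m k"
      unfolding \<zeta> by (rule mono_mat_Lmat[OF assms])
    also have "Lmat p (k * a + e) (k * c) * (Lmat p (a + (p - 1) * k * c) c * M ^\<^sub>m k) * M
        = (Lmat p (k * a + e) (k * c) * Lmat p (a + (p - 1) * k * c) c) * (M ^\<^sub>m k * M)"
      by (simp only: assoc c Lmat_carrier sq_mat_mult_carrier)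
    also have "\<dots> = Lmat p (Suc k * a + (e + (p - 1) * k * c)) (Suc k * c) * M ^\<^sub>m Suc k"
      by (simp add: Lmat_mult[OF assms] algebra_simps)
    finally show "(Lmat p a c * mono_mat p \<xi> 1) ^\<^sub>m Suc k
        = Lmat p (Suc k * a + (e + (p - 1) * k * c)) (Suc k * c) * mono_mat p \<xi> 1 ^\<^sub>m Suc k"
      unfolding M_def .
  qed
qed

lemma phi1_Lmat:
  assumes "prime p" "odd p" "1 \<le> m"
  shows "phi1 p m (Lmat p a c) = Lmat p a c"
proof -
  have p: "1 < p" "0 < p" using prime_gt_1_nat[OF assms(1)] by auto
  let ?t = "\<lambda>x::nat. (if x = 0 then a else 0) + (if x = 1 then c else 0)"
  have "Rfun p m (lin p a c) q = unit_root (p ^ 2) 0 * unit_root p (?t 0 + ?t 1 * q)" for q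
    using sum_linear_coeffs[OF p(1), of a c]
    by (intro Rfun_eq[OF assms(1,3), where t = ?t]) (simp_all add: lin_def)
  then have "Rfun p m (lin p a c) = lin p a c" by (simp add: fun_eq_iff lin_def)
  then show ?thesis
    using phi1_shift_0[OF p(2) inTpow_lin[OF assms(2,3)]] by (simp add: Lmat_def)
qed

text \<open>The phases produced by \<open>Pfun\<close> are linear and so lie in \<open>T\<close>
  again; results about \<open>N\<close> therefore apply to its image as well.\<close>

lemma phi1_K_shift_1:
  assumes "prime p" "odd p" "1 \<le> m" "N \<in> K_shift p m 1"
  shows "phi1 p m N \<in> K_shift p m 1"
proof -
  obtain \<xi> where "N = mono_mat p \<xi> 1" "inTpow p m \<xi>" using assms(4) by (auto simp: K_shift_def)
  then show ?thesis
    using phi1_shift_1[OF prime_gt_1_nat[OF assms(1)]] inTpow_lin[OF assms(2,3)]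
    by (auto simp: K_shift_def Pfun_eq_lin)
qed

lemma inverse_mod_obtain:
  fixes k p :: nat
  assumes "prime p" "\<not> p dvd k"
  obtains y where "[k * y = 1] (mod p)"
  using prime_imp_coprime[OF assms] cong_solve_coprime_nat[of k p] that by (auto simp: coprime_commute)

text \<open>If \<open>r = k mod p\<close> is nonzero, the argument is itself an \<open>r\<close>-th
  power, namely of \<open>Lmat p a' (y * c) * N\<close> with \<open>y\<close> inverse to
  \<open>r\<close>. \<open>phi1\<close> commutes with this power and, by
  \<open>Pfun_lin_mult\<close>, with the diagonal factor in its base. Expanding the power of the
  image gives back \<open>Lmat p a c\<close>, since the correction \<open>e\<close> is the
  same.\<close>

lemma phi1_Lmat_power:
  assumes "prime p" "odd p" "1 \<le> m" and N: "N \<in> K_shift p m 1"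
  shows "phi1 p m (Lmat p a c * N ^\<^sub>m k) = Lmat p a c * phi1 p m N ^\<^sub>m k"
proof -
  have p: "1 < p" "0 < p" using prime_gt_1_nat[OF assms(1)] by auto
  have np: "\<not> p dvd 1" using p by simp
  note N' = phi1_K_shift_1[OF assms]
  have red: "M ^\<^sub>m k = M ^\<^sub>m (k mod p)" if "M \<in> K_shift p m 1" for M
    using pow_mat_mod[OF K_shift_carrier[OF that] K_shift_power_p[OF assms(1) np that], of k "k mod p"]
    by (simp add: cong_def)
  define r where "r = k mod p"
  show ?thesis
  proof (cases "r = 0")
    case True
    have "N ^\<^sub>m k = 1\<^sub>m p" "phi1 p m N ^\<^sub>m k = 1\<^sub>m p"
      using red[OF N] red[OF N'] True K_shift_carrier[OF N] K_shift_carrier[OF N'] by (simp_all add: r_def)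
    then show ?thesis
      using phi1_Lmat[OF assms(1-3)] right_mult_one_mat[OF Lmat_carrier[of p a c]] by simp
  next
    case False
    have r: "0 < r" "r < p" using False p by (auto simp: r_def)
    then obtain y where y: "[r * y = 1] (mod p)"
      using inverse_mod_obtain[OF assms(1), of r] by (auto dest: nat_dvd_not_less)
    obtain e where e: "\<And>a \<xi>. (Lmat p a (y * c) * mono_mat p \<xi> 1) ^\<^sub>m r
        = Lmat p (r * a + e) (r * (y * c)) * mono_mat p \<xi> 1 ^\<^sub>m r"
      using Lmat_mult_power[OF p(2), of "y * c" r] by blast
    \<comment> \<open>The solution of \<open>r * a' + e = a\<close> modulo \<open>p\<close>, with
      \<open>p - 1\<close> in place of \<open>- 1\<close>.\<close>
    define a' where "a' = y * (a + (p - 1) * e)"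
    have "[r * y * (a + (p - 1) * e) + e = 1 * (a + (p - 1) * e) + e] (mod p)"
      by (intro cong_add cong_mult y cong_refl)
    also have "1 * (a + (p - 1) * e) + e = a + p * e"
      using p by (cases p) (auto simp: algebra_simps)
    also have "[a + p * e = a] (mod p)" by (simp add: cong_def)
    finally have ca: "[r * a' + e = a] (mod p)" by (simp add: a'_def mult.assoc)
    have cc: "[r * (y * c) = c] (mod p)"
      using cong_mult[OF y cong_refl[of c p]] by (simp add: mult.assoc)
    \<comment> \<open>Stated for every \<open>M\<close> of shift 1, because it is used for
      \<open>N\<close> and for \<open>phi1 p m N\<close>.\<close>
    have key: "(Lmat p a' (y * c) * M) ^\<^sub>m r = Lmat p a c * M ^\<^sub>m r" if "M \<in> K_shift p m 1" for M
      using that Lmat_cong[OF p(2) ca cc] e[of a'] by (auto simp: K_shift_def)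
    have LN: "Lmat p a' (y * c) * N \<in> K_shift p m 1"
      using K_shift_mult[OF p(2) Lmat_K_shift[OF assms(2,3)] N] by simp
    have "phi1 p m (Lmat p a' (y * c) * N) = Lmat p a' (y * c) * phi1 p m N"
    proof -
      obtain \<xi> where \<xi>: "N = mono_mat p \<xi> 1" "inTpow p m \<xi>" using N by (auto simp: K_shift_def)
      have i: "inTpow p m (\<lambda>q. lin p a' (y * c) q * \<xi> q)"
        using inTpow_mult_shift[OF p(2) inTpow_lin[OF assms(2,3)] \<xi>(2), of a' "y * c" 0] p \<xi>(2)
        by (simp add: inTpow_iff[OF p(2)])
      have "Pfun p m (\<lambda>q. lin p a' (y * c) q * \<xi> q) = (\<lambda>q. lin p a' (y * c) q * Pfun p m \<xi> q)"
        using Pfun_lin_mult[OF assms(1,3)] \<xi>(2) by (auto simp: inTpow_iff[OF p(2)])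
      then show ?thesis
        using phi1_shift_1[OF p(1) i] phi1_shift_1[OF p(1) \<xi>(2)] by (simp add: \<xi>(1) Lmat_mono_mat[OF p(2)])
    qed
    then have "phi1 p m (Lmat p a c * N ^\<^sub>m r) = Lmat p a c * phi1 p m N ^\<^sub>m r"
      using phi1_power[OF assms(1) LN r] key[OF N] key[OF N'] by simp
    then show ?thesis using red[OF N] red[OF N'] by (simp add: r_def)
  qed
qed

section \<open>Commutation up to scalars and multiplicativity of \<open>phi1\<close>\<close>

lemma smult_mono_mat: "k \<cdot>\<^sub>m mono_mat p \<xi> b = mono_mat p (\<lambda>q. k * \<xi> q) b"
  by (intro eq_matI) (auto simp: mono_mat_def)

lemma one_smult_mat: "(1 :: 'a :: comm_ring_1) \<cdot>\<^sub>m A = A"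
  by (intro eq_matI) auto

lemma smult_smult_mat: "(k :: 'a :: comm_ring_1) \<cdot>\<^sub>m (l \<cdot>\<^sub>m A) = (k * l) \<cdot>\<^sub>m A"
  by (intro eq_matI) (auto simp: mult.assoc)

lemma power_commute_scalar:
  fixes A B :: "'a :: comm_ring_1 mat"
  assumes A: "A \<in> carrier_mat n n" and B: "B \<in> carrier_mat n n" and "A * B = l \<cdot>\<^sub>m (B * A)"
  shows "A ^\<^sub>m k * B = l ^ k \<cdot>\<^sub>m (B * A ^\<^sub>m k)"
proof (induction k)
  case 0
  show ?case using A B by (simp add: one_smult_mat)
next
  case (Suc k)
  have Ak: "A ^\<^sub>m k \<in> carrier_mat n n" using A by simp
  have BA: "B * A \<in> carrier_mat n n" "B * A ^\<^sub>m k \<in> carrier_mat n n" using A B Ak by simp_all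
  have "A ^\<^sub>m Suc k * B = A ^\<^sub>m k * (l \<cdot>\<^sub>m (B * A))"
    using sq_mat_assoc[OF Ak A B] assms(3) by simp
  also have "\<dots> = l \<cdot>\<^sub>m (A ^\<^sub>m k * B * A)"
    using mult_smult_distrib[OF Ak BA(1), of l] sq_mat_assoc[OF Ak B A] by simp
  also have "\<dots> = l \<cdot>\<^sub>m (l ^ k \<cdot>\<^sub>m (B * A ^\<^sub>m k * A))"
    using mult_smult_assoc_mat[OF BA(2) A, of "l ^ k"] Suc by simp
  also have "\<dots> = l ^ Suc k \<cdot>\<^sub>m (B * A ^\<^sub>m Suc k)"
    using sq_mat_assoc[OF B Ak A] by (simp add: smult_smult_mat)
  finally show ?case .
qed

text \<open>Comparing phases gives \<open>d (q - 1) = l * d q\<close> cyclically, so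
  \<open>d\<close> is a geometric sequence. Closing the cycle forces \<open>l ^ p = 1\<close>, and
  the determinant condition forces \<open>d 0 ^ p = 1\<close>.\<close>

lemma diagonal_commuting_is_Lmat:
  assumes "prime p" "odd p" and N: "N \<in> K_shift p m 1" and D: "D \<in> K_shift p m 0"
    and comm: "N * D = l \<cdot>\<^sub>m (D * N)"
  obtains a c where "D = Lmat p a c"
proof -
  have p: "1 < p" "0 < p" using prime_gt_1_nat[OF assms(1)] by auto
  obtain \<xi> where \<xi>: "N = mono_mat p \<xi> 1" "inTpow p m \<xi>" using N by (auto simp: K_shift_def)
  obtain d where d: "D = mono_mat p d 0" "inTpow p m d" using D by (auto simp: K_shift_def)
  have nz: "\<xi> q \<noteq> 0" "d q \<noteq> 0" if "q < p" for q
    using inTpow_nonzero[OF p(2) \<xi>(2) that] inTpow_nonzero[OF p(2) d(2) that] by auto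
  have "mono_mat p (\<lambda>q. \<xi> q * d ((q + (p - 1)) mod p)) 1 = mono_mat p (\<lambda>q. l * (d q * \<xi> (q mod p))) 1"
    using comm p by (simp add: \<xi>(1) d(1) mono_mat_mult smult_mono_mat)
  from mono_mat_eqD(2)[OF p(2) this]
  have step: "d ((q + (p - 1)) mod p) = l * d q" if "q < p" for q
    using nz that by fastforce
  have d0: "d 0 = l ^ q * d q" if "q < p" for q
    using that
  proof (induction q)
    case (Suc q)
    have "(Suc q + (p - 1)) mod p = q" using Suc.prems p by simp
    then show ?case using step[OF Suc.prems] Suc by simp
  qed simp
  \<comment> \<open>One full turn: \<open>p - 1\<close> steps along the sequence, then the
    wrap-around step at index 0.\<close>
  have "d 0 = l ^ (p - 1) * (l * d 0)"
    using d0[of "p - 1"] step[of 0] p by simp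
  also have "\<dots> = l ^ p * d 0" using p by (cases p) auto
  finally have "l ^ p = 1" using nz[of 0] p by simp
  then have "(1 / l) ^ p = 1" by (simp add: power_divide)
  then obtain c where c: "1 / l = unit_root p c" using root_of_unity_obtain p by metis
  have dq: "d q = d 0 * unit_root p (c * q)" if "q < p" for q
  proof -
    have "unit_root p (c * q) = (1 / l) ^ q" by (simp add: c unit_root_power mult.commute)
    moreover have "l \<noteq> 0" using c by auto
    ultimately show ?thesis using d0[OF that] by (simp add: power_divide)
  qed
  have "1 = (\<Prod>q<p. d q)" using d(2) by (simp add: inTpow_iff[OF p(2)])
  also have "\<dots> = (\<Prod>q<p. d 0 * lin p 0 c q)" 
    by (intro prod.cong refl) (metis dq lin_def add_0 lessThan_iff)
  also have "\<dots> = d 0 ^ p" using prod_lin[OF assms(2)] by (simp add: prod.distrib)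
  finally have "d 0 ^ p = 1" by simp
  then obtain a where a: "d 0 = unit_root p a" using root_of_unity_obtain p by metis
  have "d q = lin p a c q" if "q < p" for q
    using dq[OF that] a by (simp add: lin_def unit_root_add)
  then have "D = Lmat p a c" unfolding d(1) Lmat_def by (intro mono_mat_cong) auto
  then show ?thesis using that by blast
qed

text \<open>With \<open>y\<close> inverse to \<open>b\<close>, the power \<open>N\<close> of
  \<open>A\<close> has shift 1 and generates \<open>A\<close>. Stripping the shift off
  \<open>B\<close> by a power of \<open>N\<close> leaves a diagonal matrix that still commutes with
  \<open>N\<close> up to a scalar, to which \<open>diagonal_commuting_is_Lmat\<close>
  applies.\<close>

lemma commuting_normal_form:
  assumes "prime p" "odd p" and A: "A \<in> K_shift p m b" and B: "B \<in> K_shift p m c"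
    and "\<not> p dvd b" and comm: "A * B = l \<cdot>\<^sub>m (B * A)"
  obtains N k a d j where "N \<in> K_shift p m 1" "A = N ^\<^sub>m k" "B = Lmat p a d * N ^\<^sub>m j"
proof -
  have p: "1 < p" "0 < p" using prime_gt_1_nat[OF assms(1)] by auto
  have np: "\<not> p dvd 1" using p by simp
  note cA = K_shift_carrier[OF A] and cB = K_shift_carrier[OF B]
  obtain y where y: "[b * y = 1] (mod p)" using inverse_mod_obtain[OF assms(1,5)] .
  define N where "N = A ^\<^sub>m y"
  have N: "N \<in> K_shift p m 1"
    using K_shift_power[OF p(2) A, of y] K_shift_cong[of "y * b" 1 p m] y
    by (simp add: N_def mult.commute)
  note cN = K_shift_carrier[OF N]
  have "N ^\<^sub>m b = A ^\<^sub>m (y * b)" using pow_mat_mult[OF cA, of y b] by (simp add: N_def)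
  also have "\<dots> = A"
    using pow_mat_mod[OF cA K_shift_power_p[OF assms(1,5) A], of "y * b" 1] y pow_mat_1[OF cA]
    by (simp add: mult.commute)
  finally have AN: "A = N ^\<^sub>m b" ..
  \<comment> \<open>The exponent stands for \<open>- c\<close>, as \<open>N\<close> has p-th power
    one.\<close>
  define D where "D = B * N ^\<^sub>m ((p - 1) * c)"
  have cNk: "N ^\<^sub>m k \<in> carrier_mat p p" for k using cN by simp
  have "c + (p - 1) * c * 1 = p * c" using p by (cases p) auto
  then have "[c + (p - 1) * c * 1 = 0] (mod p)" by (simp only: cong_0_iff dvd_triv_left)
  then have D: "D \<in> K_shift p m 0"
    using K_shift_mult[OF p(2) B K_shift_power[OF p(2) N, of "(p - 1) * c"]] K_shift_cong
    unfolding D_def by metis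
  have "(p - 1) * c + c = p * c" using p by (cases p) auto
  then have "D * N ^\<^sub>m c = B * N ^\<^sub>m (p * c)"
    unfolding D_def using sq_mat_assoc[OF cB cNk cNk] pow_mat_add[OF cN] by metis
  also have "\<dots> = B"
    using K_shift_power_p[OF assms(1) np N] cB cN by (simp add: pow_mat_mult)
  finally have BD: "B = D * N ^\<^sub>m c" ..
  have NB: "N * B = l ^ y \<cdot>\<^sub>m (B * N)"
    unfolding N_def by (rule power_commute_scalar[OF cA cB comm])
  have "N * D = (N * B) * N ^\<^sub>m ((p - 1) * c)"
    unfolding D_def using sq_mat_assoc[OF cN cB cNk] by simp
  also have "\<dots> = l ^ y \<cdot>\<^sub>m (B * N * N ^\<^sub>m ((p - 1) * c))"
    unfolding NB by (rule mult_smult_assoc_mat[OF sq_mat_mult_carrier[OF cB cN] cNk])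
  also have "B * N * N ^\<^sub>m ((p - 1) * c) = B * (N ^\<^sub>m ((p - 1) * c) * N)"
    using sq_mat_assoc[OF cB cN cNk] pow_mat_add[OF cN, of 1 "(p - 1) * c"]
      pow_mat_add[OF cN, of "(p - 1) * c" 1] pow_mat_1[OF cN] by (metis add.commute)
  also have "\<dots> = D * N" unfolding D_def using sq_mat_assoc[OF cB cNk cN] by simp
  finally obtain a d where "D = Lmat p a d"
    using diagonal_commuting_is_Lmat[OF assms(1,2) N D] by blast
  then show ?thesis using that[OF N AN] BD by blast
qed

text \<open>Brings a product back to normal form. The coefficients depend on the exponents and not
  on \<open>N\<close>, so the same formula holds for the image of \<open>N\<close>.\<close>

lemma power_mult_Lmat_power:
  assumes "0 < p" "N \<in> K_shift p m 1"
  shows "N ^\<^sub>m k * (Lmat p a d * N ^\<^sub>m j) = Lmat p (a + (p - 1) * k * d) d * N ^\<^sub>m (k + j)"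
proof -
  have c: "N \<in> carrier_mat p p" using K_shift_carrier[OF assms(2)] .
  then have ck: "N ^\<^sub>m i \<in> carrier_mat p p" for i by simp
  obtain \<xi> where \<xi>: "N ^\<^sub>m k = mono_mat p \<xi> k"
    using K_shift_power[OF assms, of k] by (auto simp: K_shift_def)
  have "N ^\<^sub>m k * (Lmat p a d * N ^\<^sub>m j) = (N ^\<^sub>m k * Lmat p a d) * N ^\<^sub>m j"
    using sq_mat_assoc[OF ck Lmat_carrier ck] by simp
  also have "N ^\<^sub>m k * Lmat p a d = Lmat p (a + (p - 1) * k * d) d * N ^\<^sub>m k"
    unfolding \<xi> by (rule mono_mat_Lmat[OF assms(1)])
  finally show ?thesis
    using sq_mat_assoc[OF Lmat_carrier ck ck] pow_mat_add[OF c] by metis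
qed

text \<open>The determinant condition gives \<open>\<alpha> ^ p = 1\<close>, so
  \<open>\<alpha>\<close> has a p-th root \<open>unit_root (p ^ 2) s\<close>. Dividing by it leaves
  p-th roots of unity, whose exponents are interpolated by a polynomial. For \<open>m = 1\<close>
  the scalar \<open>\<alpha>\<close> is 1, whence \<open>p dvd s\<close>.\<close>

lemma scalar_power_form:
  assumes "prime p" "1 \<le> m" "inTpow p m \<xi>" and \<alpha>: "\<And>q. q < p \<Longrightarrow> \<xi> q ^ p = \<alpha>"
  obtains s t where "2 \<le> m \<or> p dvd s"
    "\<And>q. q < p \<Longrightarrow> \<xi> q = unit_root (p ^ 2) s * unit_root p (\<Sum>x<p. t x * q ^ x)"
proof -
  have p: "1 < p" "0 < p" using prime_gt_1_nat[OF assms(1)] by auto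
  have "\<alpha> ^ p = (\<Prod>q<p. \<xi> q ^ p)" using \<alpha> by simp
  also have "\<dots> = 1" using assms(3) by (simp add: inTpow_iff[OF p(2)] flip: prod_power_distrib)
  finally obtain s where s: "\<alpha> = unit_root p s" using root_of_unity_obtain p by metis
  have s2: "2 \<le> m \<or> p dvd s"
  proof (cases "2 \<le> m")
    case False
    then have "m = 1" using assms(2) by simp
    then have "\<xi> 0 ^ p = 1" using assms(3) p by (simp add: inTpow_iff[OF p(2)])
    then show ?thesis using \<alpha>[of 0] s p by (simp add: unit_root_eq_1_iff)
  qed simp
  have low: "unit_root (p ^ 2) s ^ p = unit_root p s"
    using unit_root_cancel[OF p(2), of p s] by (simp add: unit_root_power power2_eq_square mult.commute)
  have "\<exists>g. \<xi> q / unit_root (p ^ 2) s = unit_root p g" if "q < p" for q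
  proof -
    have "(\<xi> q / unit_root (p ^ 2) s) ^ p = 1" using \<alpha>[OF that] low s by (simp add: power_divide)
    then show ?thesis using root_of_unity_obtain p by metis
  qed
  then obtain g where g: "\<And>q. q < p \<Longrightarrow> \<xi> q / unit_root (p ^ 2) s = unit_root p (g q)" by metis
  obtain t where t: "\<And>q. q < p \<Longrightarrow> [(\<Sum>x<p. t x * q ^ x) = g q] (mod p)"
    using interpolation_mod_prime[OF assms(1)] by metis
  have "\<xi> q = unit_root (p ^ 2) s * unit_root p (\<Sum>x<p. t x * q ^ x)" if "q < p" for q
    using g[OF that] unit_root_cong[OF p(2) t[OF that]] by (simp add: field_simps)
  then show ?thesis using that s2 by blast
qed

text \<open>The forms from \<open>scalar_power_form\<close> multiply by adding \<open>s\<close> and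
  \<open>t\<close>. \<open>Rfun_eq\<close> puts no bound on \<open>s\<close>, so it applies to the
  sum directly.\<close>

lemma phi1_mult_diagonal:
  assumes "prime p" "1 \<le> m" and A: "A \<in> K_shift p m 0" and B: "B \<in> K_shift p m 0"
    and "A ^\<^sub>m p = \<alpha> \<cdot>\<^sub>m 1\<^sub>m p" "B ^\<^sub>m p = \<beta> \<cdot>\<^sub>m 1\<^sub>m p"
  shows "phi1 p m (A * B) = phi1 p m A * phi1 p m B"
proof -
  have p: "1 < p" "0 < p" using prime_gt_1_nat[OF assms(1)] by auto
  obtain \<xi> where \<xi>: "A = mono_mat p \<xi> 0" "inTpow p m \<xi>" using A by (auto simp: K_shift_def)
  obtain \<eta> where \<eta>: "B = mono_mat p \<eta> 0" "inTpow p m \<eta>" using B by (auto simp: K_shift_def)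
  have const: "\<zeta> q ^ p = \<gamma>"
    if "mono_mat p \<zeta> 0 ^\<^sub>m p = \<gamma> \<cdot>\<^sub>m 1\<^sub>m p" "inTpow p m \<zeta>" "q < p" for \<zeta> \<gamma> q
  proof -
    have "mono_mat p (\<lambda>q. \<zeta> q ^ p) 0 = mono_mat p (\<lambda>_. \<gamma>) 0"
      using that(1) p by (simp add: mono_mat_0_power one_mat_mono smult_mono_mat)
    from mono_mat_eqD(2)[OF p(2) this _ that(3)] show ?thesis
      using inTpow_nonzero[OF p(2) that(2)] by simp
  qed
  obtain s t where st: "2 \<le> m \<or> p dvd s"
    "\<And>q. q < p \<Longrightarrow> \<xi> q = unit_root (p ^ 2) s * unit_root p (\<Sum>x<p. t x * q ^ x)"
    using scalar_power_form[OF assms(1,2) \<xi>(2) const[OF assms(5)[unfolded \<xi>(1)] \<xi>(2)]] by blast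
  obtain s' t' where st': "2 \<le> m \<or> p dvd s'"
    "\<And>q. q < p \<Longrightarrow> \<eta> q = unit_root (p ^ 2) s' * unit_root p (\<Sum>x<p. t' x * q ^ x)"
    using scalar_power_form[OF assms(1,2) \<eta>(2) const[OF assms(6)[unfolded \<eta>(1)] \<eta>(2)]] by blast
  have i: "inTpow p m (\<lambda>q. \<xi> q * \<eta> q)"
    using \<xi>(2) \<eta>(2) by (simp add: inTpow_iff[OF p(2)] prod.distrib norm_mult power_mult_distrib)
  have AB: "mono_mat p \<zeta> 0 * mono_mat p \<theta> 0 = mono_mat p (\<lambda>q. \<zeta> q * \<theta> q) 0" for \<zeta> \<theta>
    using p by (simp add: mono_mat_mult) (intro mono_mat_cong, auto)
  have "Rfun p m (\<lambda>q. \<xi> q * \<eta> q) q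
      = unit_root (p ^ 2) (s + s') * unit_root p ((t 0 + t' 0) + (t 1 + t' 1) * q)" for q
    using st st' by (intro Rfun_eq[OF assms(1,2), where t = "\<lambda>x. t x + t' x"])
      (auto simp: unit_root_add distrib_right sum.distrib)
  moreover have "Rfun p m \<xi> q = unit_root (p ^ 2) s * unit_root p (t 0 + t 1 * q)" for q
    using Rfun_eq[OF assms(1,2) st] .
  moreover have "Rfun p m \<eta> q = unit_root (p ^ 2) s' * unit_root p (t' 0 + t' 1 * q)" for q
    using Rfun_eq[OF assms(1,2) st'] .
  ultimately have "Rfun p m (\<lambda>q. \<xi> q * \<eta> q) = (\<lambda>q. Rfun p m \<xi> q * Rfun p m \<eta> q)"
    by (simp add: fun_eq_iff unit_root_add distrib_right)
  then show ?thesis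
    using phi1_shift_0[OF p(2) i] phi1_shift_0[OF p(2) \<xi>(2)] phi1_shift_0[OF p(2) \<eta>(2)]
    by (simp add: \<xi>(1) \<eta>(1) AB)
qed

lemma K_shift_nonzero:
  assumes "0 < p" "A \<in> K_shift p m b"
  shows "A \<noteq> 0\<^sub>m p p"
proof
  assume A0: "A = 0\<^sub>m p p"
  obtain \<xi> where \<xi>: "A = mono_mat p \<xi> b" "inTpow p m \<xi>" using assms(2) by (auto simp: K_shift_def)
  have "A $$ (b mod p, 0) = \<xi> (b mod p)" using assms(1) by (simp add: \<xi>(1) mono_mat_def)
  then show False using inTpow_nonzero[OF assms(1) \<xi>(2), of "b mod p"] assms(1) A0 by simp
qed

text \<open>If a factor is nondiagonal, both factors and their product are normal forms over one
  \<open>N\<close>, on which \<open>phi1\<close> merely replaces \<open>N\<close> by its image.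
  Otherwise \<open>phi1_mult_diagonal\<close> applies.\<close>

lemma phi1_mult:
  assumes "prime p" "odd p" "1 \<le> m" and A: "A \<in> K_shift p m b" and B: "B \<in> K_shift p m c"
    and pow: "A ^\<^sub>m p = \<alpha> \<cdot>\<^sub>m 1\<^sub>m p" "B ^\<^sub>m p = \<beta> \<cdot>\<^sub>m 1\<^sub>m p"
    and comm: "A * B = l \<cdot>\<^sub>m (B * A)"
  shows "phi1 p m (A * B) = phi1 p m A * phi1 p m B"
proof -
  have p: "1 < p" "0 < p" using prime_gt_1_nat[OF assms(1)] by auto
  note phi1_L = phi1_Lmat_power[OF assms(1-3)]
  have one: "phi1 p m (N ^\<^sub>m k) = phi1 p m N ^\<^sub>m k" if N: "N \<in> K_shift p m 1" for N k
    using phi1_L[OF N, of 0 0 k] K_shift_carrier[OF N]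
      K_shift_carrier[OF phi1_K_shift_1[OF assms(1-3) N]] by (simp add: Lmat_0)
  consider "\<not> p dvd b" | "\<not> p dvd c" | "p dvd b" "p dvd c" by blast
  then show ?thesis
  proof cases
    case 1
    obtain N k a d j where N: "N \<in> K_shift p m 1" "A = N ^\<^sub>m k" "B = Lmat p a d * N ^\<^sub>m j"
      using commuting_normal_form[OF assms(1,2) A B 1 comm] .
    show ?thesis
      unfolding N(2,3) power_mult_Lmat_power[OF p(2) N(1)] phi1_L[OF N(1)] one[OF N(1)]
        power_mult_Lmat_power[OF p(2) phi1_K_shift_1[OF assms(1-3) N(1)]] ..
  next
    case 2
    \<comment> \<open>Exchanging the roles of \<open>A\<close> and \<open>B\<close> inverts
      \<open>l\<close>, which is nonzero because the product is.\<close>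
    have "A * B \<noteq> 0\<^sub>m p p" by (rule K_shift_nonzero[OF p(2) K_shift_mult[OF p(2) A B]])
    moreover have cBA: "B * A \<in> carrier_mat p p"
      using K_shift_carrier[OF A] K_shift_carrier[OF B] by simp
    moreover have "0 \<cdot>\<^sub>m M = 0\<^sub>m p p" if "M \<in> carrier_mat p p" for M :: "complex mat"
      using that by (intro eq_matI) auto
    ultimately have "l \<noteq> 0" using comm by metis
    then have "B * A = inverse l \<cdot>\<^sub>m (A * B)"
      unfolding comm by (simp add: smult_smult_mat one_smult_mat)
    then obtain N k a d j where N: "N \<in> K_shift p m 1" "B = N ^\<^sub>m k" "A = Lmat p a d * N ^\<^sub>m j"
      using commuting_normal_form[OF assms(1,2) B A 2] by metis
    have add: "Lmat p a d * M ^\<^sub>m j * M ^\<^sub>m k = Lmat p a d * M ^\<^sub>m (j + k)" if "M \<in> K_shift p m 1" for M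
    proof -
      have "M ^\<^sub>m i \<in> carrier_mat p p" for i using K_shift_carrier[OF that] by simp
      then show ?thesis
        using sq_mat_assoc[OF Lmat_carrier] pow_mat_add[OF K_shift_carrier[OF that]] by metis
    qed
    show ?thesis
      unfolding N(2,3) phi1_L[OF N(1)] one[OF N(1)] add[OF N(1)]
        add[OF phi1_K_shift_1[OF assms(1-3) N(1)]] ..
  next
    case 3
    then have "A \<in> K_shift p m 0" "B \<in> K_shift p m 0"
      using A B K_shift_cong[of b 0 p m] K_shift_cong[of c 0 p m] by (simp_all add: cong_0_iff)
    then show ?thesis using phi1_mult_diagonal[OF assms(1,3) _ _ pow] by blast
  qed
qed

lemma phi1_carrier:
  assumes "prime p" "odd p" "1 \<le> m" "A \<in> Kset p m"
  shows "phi1 p m A \<in> carrier_mat p p"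
proof -
  have p: "1 < p" "0 < p" using prime_gt_1_nat[OF assms(1)] by auto
  obtain b where b: "b < p" "A \<in> K_shift p m b" using assms(4) by (auto simp: Kset_eq[OF p(2)])
  show ?thesis
  proof (cases "b = 0")
    case True
    then show ?thesis using b phi1_shift_0[OF p(2)] by (auto simp: K_shift_def)
  next
    case False
    then have "\<not> p dvd b" using b(1) by (auto dest: nat_dvd_not_less)
    \<comment> \<open>\<open>A\<close> commutes with itself, so the normal form provides the
      representation of \<open>A\<close> as a power of some \<open>N\<close>.\<close>
    moreover have "A * A = 1 \<cdot>\<^sub>m (A * A)" by (simp add: one_smult_mat)
    ultimately obtain N k where N: "N \<in> K_shift p m 1" "A = N ^\<^sub>m k"
      using commuting_normal_form[OF assms(1,2) b(2) b(2)] by metis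
    have "phi1 p m (Lmat p 0 0 * N ^\<^sub>m k) \<in> carrier_mat p p"
      unfolding phi1_Lmat_power[OF assms(1-3) N(1)]
      using K_shift_carrier[OF phi1_K_shift_1[OF assms(1-3) N(1)]]
      by (intro sq_mat_mult_carrier Lmat_carrier pow_carrier_mat)
    then show ?thesis unfolding N(2) Lmat_0 left_mult_one_mat[OF pow_carrier_mat[OF K_shift_carrier[OF N(1)]]] .
  qed
qed

subsection \<open>Kronecker products\<close>

lemma kron_carrier: "A \<in> carrier_mat a b \<Longrightarrow> B \<in> carrier_mat c d \<Longrightarrow> kron A B \<in> carrier_mat (a * c) (b * d)"
  by (simp add: kron_def)

lemma kron_index:
  assumes "A \<in> carrier_mat a b" "B \<in> carrier_mat c d" "i < a * c" "j < b * d"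
  shows "kron A B $$ (i, j) = A $$ (i div c, j div d) * B $$ (i mod c, j mod d)"
  using assms by (simp add: kron_def)

lemma sum_div_mod:
  fixes f :: "nat \<Rightarrow> nat \<Rightarrow> 'a :: comm_monoid_add"
  shows "(\<Sum>k<a * b. f (k div b) (k mod b)) = (\<Sum>i<a. \<Sum>j<b. f i j)"
proof -
  have "(\<Sum>i<a. \<Sum>j<b. f i j) = (\<Sum>(i, j)\<in>{..<a} \<times> {..<b}. f i j)"
    by (rule sum.cartesian_product)
  also have "\<dots> = (\<Sum>k<a * b. f (k div b) (k mod b))"
  proof (rule sum.reindex_bij_witness[where i = "\<lambda>k. (k div b, k mod b)" and j = "\<lambda>(i, j). i * b + j"])
    fix x assume "x \<in> {..<a} \<times> {..<b}"
    then obtain i j where x: "x = (i, j)" "i < a" "j < b" by auto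
    have "i * b + j < Suc i * b" using x by simp
    also have "\<dots> \<le> a * b" using x by (intro mult_le_mono1) simp
    finally show "(case x of (i, j) \<Rightarrow> i * b + j) \<in> {..<a * b}" using x by simp
  next
    fix k assume "k \<in> {..<a * b}"
    then show "(k div b, k mod b) \<in> {..<a} \<times> {..<b}"
      by (cases "b = 0") (auto simp: less_mult_imp_div_less)
  qed auto
  finally show ?thesis ..
qed

text \<open>The mixed-product rule: \<open>sum_div_mod\<close> splits the inner index
  \<open>k\<close> into \<open>k div e\<close> and \<open>k mod e\<close>, and the double sum
  factors.\<close>

lemma kron_mult:
  assumes A: "A \<in> carrier_mat a b" and B: "B \<in> carrier_mat d e"
    and C: "C \<in> carrier_mat b c" and D: "D \<in> carrier_mat e f"
  shows "kron A B * kron C D = kron (A * C) (B * D)"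
proof (rule eq_matI)
  note cs = kron_carrier[OF A B] kron_carrier[OF C D]
    kron_carrier[OF mult_carrier_mat[OF A C] mult_carrier_mat[OF B D]]
  fix i j assume "i < dim_row (kron (A * C) (B * D))" "j < dim_col (kron (A * C) (B * D))"
  then have i: "i < a * d" and j: "j < c * f" using cs by auto
  have id: "i div d < a" "i mod d < d" and jd: "j div f < c" "j mod f < f"
    using i j by (auto simp: less_mult_imp_div_less) (cases "d = 0"; cases "f = 0"; simp)+
  have "(kron A B * kron C D) $$ (i, j) = (\<Sum>k<b * e. kron A B $$ (i, k) * kron C D $$ (k, j))"
    using i j cs by (simp add: scalar_prod_def atLeast0LessThan)
  also have "\<dots> = (\<Sum>k<b * e. (A $$ (i div d, k div e) * C $$ (k div e, j div f))
      * (B $$ (i mod d, k mod e) * D $$ (k mod e, j mod f)))"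
    using i j by (intro sum.cong) (auto simp: kron_index[OF A B] kron_index[OF C D])
  also have "\<dots> = (\<Sum>x<b. \<Sum>y<e. (A $$ (i div d, x) * C $$ (x, j div f))
      * (B $$ (i mod d, y) * D $$ (y, j mod f)))"
    by (rule sum_div_mod)
  also have "\<dots> = (\<Sum>x<b. A $$ (i div d, x) * C $$ (x, j div f))
      * (\<Sum>y<e. B $$ (i mod d, y) * D $$ (y, j mod f))"
    by (simp add: sum_product)
  also have "\<dots> = (A * C) $$ (i div d, j div f) * (B * D) $$ (i mod d, j mod f)"
    using A B C D id jd by (simp add: scalar_prod_def atLeast0LessThan)
  finally show "(kron A B * kron C D) $$ (i, j) = kron (A * C) (B * D) $$ (i, j)"
    using kron_index[OF mult_carrier_mat[OF A C] mult_carrier_mat[OF B D] i j] by simp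
qed (use kron_carrier[OF A B] kron_carrier[OF C D]
    kron_carrier[OF mult_carrier_mat[OF A C] mult_carrier_mat[OF B D]] in auto)

lemma kron_one: "kron (1\<^sub>m a) (1\<^sub>m b) = 1\<^sub>m (a * b)"
proof (rule eq_matI)
  fix i j assume "i < dim_row (1\<^sub>m (a * b))" "j < dim_col (1\<^sub>m (a * b))"
  then have ij: "i < a * b" "j < a * b" by simp_all
  then have "0 < b" by (cases b) auto
  moreover have "i = j \<longleftrightarrow> i div b = j div b \<and> i mod b = j mod b" by (metis div_mult_mod_eq)
  ultimately show "kron (1\<^sub>m a) (1\<^sub>m b) $$ (i, j) = 1\<^sub>m (a * b) $$ (i, j)"
    using ij by (auto simp: kron_def less_mult_imp_div_less)
qed (simp_all add: kron_def)

text \<open>All products of an entry of \<open>A\<close> with one of \<open>B\<close> agree with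
  those of \<open>C\<close> and \<open>D\<close>; dividing by a fixed nonzero entry of one factor
  expresses the other as a multiple.\<close>

lemma kron_eq_scalar:
  assumes A: "A \<in> carrier_mat a a" and B: "B \<in> carrier_mat b b"
    and C: "C \<in> carrier_mat a a" and D: "D \<in> carrier_mat b b"
    and eq: "kron A B = kron C D" and nz: "A \<noteq> 0\<^sub>m a a" "B \<noteq> 0\<^sub>m b b"
  shows "\<exists>l. A = l \<cdot>\<^sub>m C" "\<exists>l. B = l \<cdot>\<^sub>m D"
proof -
  have prod: "A $$ (i, j) * B $$ (r, s) = C $$ (i, j) * D $$ (r, s)"
    if "i < a" "j < a" "r < b" "s < b" for i j r s
  proof -
    have lt: "x * b + y < a * b" if "x < a" "y < b" for x y
    proof -
      have "x * b + y < Suc x * b" using that by simp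
      also have "\<dots> \<le> a * b" using that by (intro mult_le_mono1) simp
      finally show ?thesis .
    qed
    have "kron A B $$ (i * b + r, j * b + s) = kron C D $$ (i * b + r, j * b + s)" using eq by simp
    then show ?thesis
      using that lt by (simp add: kron_index[OF A B] kron_index[OF C D])
  qed
  obtain i j where ij: "i < a" "j < a" "A $$ (i, j) \<noteq> 0"
    using nz(1) A by (metis (no_types, lifting) carrier_matD eq_matI index_zero_mat)
  obtain r s where rs: "r < b" "s < b" "B $$ (r, s) \<noteq> 0"
    using nz(2) B by (metis (no_types, lifting) carrier_matD eq_matI index_zero_mat)
  show "\<exists>l. A = l \<cdot>\<^sub>m C"
    by (intro exI[of _ "D $$ (r, s) / B $$ (r, s)"] eq_matI)
      (use A C prod rs in \<open>auto simp: field_simps\<close>)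
  show "\<exists>l. B = l \<cdot>\<^sub>m D"
    by (intro exI[of _ "C $$ (i, j) / A $$ (i, j)"] eq_matI)
      (use B D prod ij in \<open>auto simp: field_simps\<close>)
qed

lemma kron_nonzero:
  assumes A: "A \<in> carrier_mat a a" and B: "B \<in> carrier_mat b b"
    and nz: "A \<noteq> 0\<^sub>m a a" "B \<noteq> 0\<^sub>m b b"
  shows "kron A B \<noteq> 0\<^sub>m (a * b) (a * b)"
proof
  assume "kron A B = 0\<^sub>m (a * b) (a * b)"
  also have "\<dots> = kron (0\<^sub>m a a) (0\<^sub>m b b)"
  proof (rule eq_matI)
    fix i j assume "i < dim_row (kron (0\<^sub>m a a) (0\<^sub>m b b))" "j < dim_col (kron (0\<^sub>m a a) (0\<^sub>m b b))"
    then have ij: "i < a * b" "j < a * b" by (simp_all add: kron_def)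
    then have "0 < b" by (cases b) auto
    with ij show "0\<^sub>m (a * b) (a * b) $$ (i, j) = kron (0\<^sub>m a a) (0\<^sub>m b b) $$ (i, j)"
      by (simp add: kron_def less_mult_imp_div_less)
  qed (simp_all add: kron_def)
  finally obtain l where "A = l \<cdot>\<^sub>m 0\<^sub>m a a"
    using kron_eq_scalar(1)[OF A B zero_carrier_mat zero_carrier_mat _ nz] by blast
  then show False using nz(1) by simp
qed

section \<open>Kronecker products of lists\<close>

lemma kron_list_Nil: "kron_list [] = 1\<^sub>m 1"
  by (simp add: kron_list_def)

lemma kron_list_Cons: "kron_list (M # Ms) = kron M (kron_list Ms)"
  by (simp add: kron_list_def)

lemma kron_list_carrier:
  "set Ms \<subseteq> carrier_mat p p \<Longrightarrow> kron_list Ms \<in> carrier_mat (p ^ length Ms) (p ^ length Ms)"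
  by (induction Ms) (auto simp: kron_list_Nil kron_list_Cons intro: kron_carrier)

lemma kron_list_mult:
  assumes "length Ms = length Ns" "set Ms \<subseteq> carrier_mat p p" "set Ns \<subseteq> carrier_mat p p"
  shows "kron_list Ms * kron_list Ns = kron_list (map2 (*) Ms Ns)"
  using assms
proof (induction Ms Ns rule: list_induct2)
  case (Cons M Ms N Ns)
  then show ?case
    using kron_list_carrier[of Ms p] kron_list_carrier[of Ns p]
    by (simp add: kron_list_Cons kron_mult[of M p p _ "p ^ length Ns" "p ^ length Ns" N p _ "p ^ length Ns"])
qed (simp add: kron_list_Nil)

lemma kron_list_power:
  assumes "set Ms \<subseteq> carrier_mat p p"
  shows "kron_list Ms ^\<^sub>m k = kron_list (map (\<lambda>M. M ^\<^sub>m k) Ms)"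
proof (induction k)
  case 0
  have "kron_list (map (\<lambda>M. 1\<^sub>m (dim_row M)) Ms) = 1\<^sub>m (p ^ length Ms)"
    using assms by (induction Ms) (auto simp: kron_list_Nil kron_list_Cons kron_one)
  then show ?case using kron_list_carrier[OF assms] by simp
next
  case (Suc k)
  have "map2 (*) (map (\<lambda>M. M ^\<^sub>m k) Ms) Ms = map (\<lambda>M. M ^\<^sub>m Suc k) Ms"
    by (induction Ms) auto
  moreover have "set (map (\<lambda>M. M ^\<^sub>m k) Ms) \<subseteq> carrier_mat p p" using assms by auto
  ultimately show ?case using kron_list_mult[OF _ _ assms, of "map (\<lambda>M. M ^\<^sub>m k) Ms"] Suc by simp
qed

lemma kron_list_nonzero:
  assumes "set Ms \<subseteq> carrier_mat p p" "\<And>M. M \<in> set Ms \<Longrightarrow> M \<noteq> 0\<^sub>m p p"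
  shows "kron_list Ms \<noteq> 0\<^sub>m (p ^ length Ms) (p ^ length Ms)"
  using assms
proof (induction Ms)
  case Nil
  have "(1\<^sub>m 1 :: complex mat) $$ (0, 0) \<noteq> 0\<^sub>m 1 1 $$ (0, 0)" by simp
  then show ?case unfolding kron_list_Nil list.size power_0 by metis
next
  case (Cons M Ms)
  then show ?case
    using kron_nonzero[of M p "kron_list Ms" "p ^ length Ms"] kron_list_carrier[of Ms p]
    by (simp add: kron_list_Cons)
qed

text \<open>Iterates \<open>kron_eq_scalar\<close>. The scalar is kept general because each step
  passes a new one on to the tail of the list.\<close>

lemma kron_list_eq_scalar:
  assumes "length Ms = length Ns" "set Ms \<subseteq> carrier_mat p p" "set Ns \<subseteq> carrier_mat p p"
    and "kron_list Ms = l \<cdot>\<^sub>m kron_list Ns" and "\<And>M. M \<in> set Ms \<Longrightarrow> M \<noteq> 0\<^sub>m p p"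
  shows "list_all2 (\<lambda>M N. \<exists>l. M = l \<cdot>\<^sub>m N) Ms Ns"
  using assms
proof (induction Ms Ns arbitrary: l rule: list_induct2)
  case (Cons M Ms N Ns)
  have c: "M \<in> carrier_mat p p" "N \<in> carrier_mat p p" "set Ms \<subseteq> carrier_mat p p" "set Ns \<subseteq> carrier_mat p p"
    using Cons.prems by auto
  have cl: "kron_list Ms \<in> carrier_mat (p ^ length Ms) (p ^ length Ms)"
    "l \<cdot>\<^sub>m kron_list Ns \<in> carrier_mat (p ^ length Ms) (p ^ length Ms)"
    using kron_list_carrier[OF c(3)] kron_list_carrier[OF c(4)] Cons.hyps by simp_all
  have "l \<cdot>\<^sub>m kron N K = kron N (l \<cdot>\<^sub>m K)" for K
  proof (rule eq_matI)
    fix i j assume "i < dim_row (kron N (l \<cdot>\<^sub>m K))" "j < dim_col (kron N (l \<cdot>\<^sub>m K))"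
    then have "i < dim_row N * dim_row K" "j < dim_col N * dim_col K" by (simp_all add: kron_def)
    moreover from this have "0 < dim_row K" "0 < dim_col K" by (auto intro: Nat.gr0I)
    ultimately show "(l \<cdot>\<^sub>m kron N K) $$ (i, j) = kron N (l \<cdot>\<^sub>m K) $$ (i, j)"
      by (simp add: kron_def less_mult_imp_div_less)
  qed (simp_all add: kron_def)
  then have eq: "kron M (kron_list Ms) = kron N (l \<cdot>\<^sub>m kron_list Ns)"
    using Cons.prems(3) by (simp add: kron_list_Cons)
  have nz: "M \<noteq> 0\<^sub>m p p" "kron_list Ms \<noteq> 0\<^sub>m (p ^ length Ms) (p ^ length Ms)"
    using Cons.prems(4) kron_list_nonzero[OF c(3)] by auto
  obtain l' where "kron_list Ms = l' \<cdot>\<^sub>m (l \<cdot>\<^sub>m kron_list Ns)"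
    using kron_eq_scalar(2)[OF c(1) cl(1) c(2) cl(2) eq nz] by blast
  then have "list_all2 (\<lambda>M N. \<exists>l. M = l \<cdot>\<^sub>m N) Ms Ns"
    using Cons.IH[OF c(3,4), of "l' * l"] Cons.prems(4) by (simp add: smult_smult_mat)
  then show ?case using kron_eq_scalar(1)[OF c(1) cl(1) c(2) cl(2) eq nz] by simp
qed simp

section \<open>Passage from the whole product to its factors\<close>

lemma K_pow_scalar:
  assumes "prime p" "set Ms \<subseteq> Kset p m" "kron_list Ms ^\<^sub>m p = 1\<^sub>m (p ^ length Ms)" "M \<in> set Ms"
  shows "\<exists>\<alpha>. M ^\<^sub>m p = \<alpha> \<cdot>\<^sub>m 1\<^sub>m p"
proof -
  have p: "0 < p" using prime_gt_0_nat[OF assms(1)] .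
  \<comment> \<open>The p-th power of the product is the Kronecker product of \<open>?Ps\<close> and
    the identity is that of \<open>?Is\<close>, so corresponding factors are proportional.\<close>
  let ?Ps = "map (\<lambda>M. M ^\<^sub>m p) Ms" and ?Is = "replicate (length Ms) (1\<^sub>m p)"
  have c: "set Ms \<subseteq> carrier_mat p p" using assms(2) K_shift_carrier by (auto simp: Kset_eq[OF p])
  have one: "kron_list (replicate k (1\<^sub>m p)) = 1\<^sub>m (p ^ k)" for k
    by (induction k) (auto simp: kron_list_Nil kron_list_Cons kron_one)
  have eq: "kron_list ?Ps = 1 \<cdot>\<^sub>m kron_list ?Is"
    using assms(3) by (simp add: one one_smult_mat flip: kron_list_power[OF c])
  have nz: "P \<noteq> 0\<^sub>m p p" if "P \<in> set ?Ps" for P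
  proof -
    obtain M where M: "M \<in> set Ms" "P = M ^\<^sub>m p" using \<open>P \<in> set ?Ps\<close> by auto
    then obtain b where "M \<in> K_shift p m b" using assms(2) by (auto simp: Kset_eq[OF p])
    then show ?thesis unfolding M(2) by (rule K_shift_nonzero[OF p K_shift_power[OF p]])
  qed
  have "list_all2 (\<lambda>M N. \<exists>l. M = l \<cdot>\<^sub>m N) ?Ps ?Is"
    by (rule kron_list_eq_scalar[OF _ _ _ eq nz]) (use c in auto)
  then have "\<forall>i<length Ms. \<exists>l. Ms ! i ^\<^sub>m p = l \<cdot>\<^sub>m 1\<^sub>m p"
    by (simp add: list_all2_conv_all_nth)
  then show ?thesis using assms(4) by (metis in_set_conv_nth)
qed

theorem theorem2:
  fixes p m n :: nat and Ms Ms' :: "complex mat list"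
  assumes "prime p" and "odd p" and "m \<ge> 1" and "n \<ge> 1"
    and "length Ms = n" and "length Ms' = n"
    and "set Ms \<subseteq> Kset p m" and "set Ms' \<subseteq> Kset p m"
    and "kron_list Ms ^\<^sub>m p = 1\<^sub>m (p ^ n)"
    and "kron_list Ms' ^\<^sub>m p = 1\<^sub>m (p ^ n)"
    and "kron_list Ms * kron_list Ms' = kron_list Ms' * kron_list Ms"
  shows "phi p m (map2 (*) Ms Ms') = phi p m Ms * phi p m Ms'"
proof -
  have p: "0 < p" using prime_gt_0_nat[OF assms(1)] .
  have len: "length Ms = length Ms'" using assms(5,6) by simp
  have c: "set Ms \<subseteq> carrier_mat p p" "set Ms' \<subseteq> carrier_mat p p"
    using assms(7,8) K_shift_carrier by (auto simp: Kset_eq[OF p])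
  have ex: "\<exists>b. M \<in> K_shift p m b" if "M \<in> set Ms \<or> M \<in> set Ms'" for M
    using that assms(7,8) by (auto simp: Kset_eq[OF p])
  \<comment> \<open>Commuting products mean that the factorwise products in either order have the
    same Kronecker product, so each pair of factors commutes up to a scalar.\<close>
  have comm: "list_all2 (\<lambda>M N. \<exists>l. M = l \<cdot>\<^sub>m N) (map2 (*) Ms Ms') (map2 (*) Ms' Ms)"
  proof (rule kron_list_eq_scalar)
    show "kron_list (map2 (*) Ms Ms') = 1 \<cdot>\<^sub>m kron_list (map2 (*) Ms' Ms)"
      using assms(11) kron_list_mult[OF len c] kron_list_mult[OF len[symmetric] c(2,1)]
      by (simp add: one_smult_mat)
    show "M \<noteq> 0\<^sub>m p p" if M: "M \<in> set (map2 (*) Ms Ms')" for M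
    proof -
      obtain A B where "A \<in> set Ms" "B \<in> set Ms'" "M = A * B"
        using M by (auto elim!: in_set_zipE)
      then show ?thesis using ex K_shift_nonzero[OF p K_shift_mult[OF p]] by metis
    qed
  qed (use len c in \<open>auto elim!: in_set_zipE intro!: sq_mat_mult_carrier\<close>)
  have "phi1 p m (A * B) = phi1 p m A * phi1 p m B" if "(A, B) \<in> set (zip Ms Ms')" for A B
  proof -
    obtain i where i: "i < length Ms" "A = Ms ! i" "B = Ms' ! i"
      using \<open>(A, B) \<in> set (zip Ms Ms')\<close> by (auto simp: set_zip)
    then have AB: "A \<in> set Ms" "B \<in> set Ms'" using len by auto
    obtain b b' where "A \<in> K_shift p m b" "B \<in> K_shift p m b'" using ex AB by blast
    moreover obtain \<alpha> where "A ^\<^sub>m p = \<alpha> \<cdot>\<^sub>m 1\<^sub>m p"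
      using K_pow_scalar[OF assms(1,7) _ AB(1)] assms(5,9) by blast
    moreover obtain \<beta> where "B ^\<^sub>m p = \<beta> \<cdot>\<^sub>m 1\<^sub>m p"
      using K_pow_scalar[OF assms(1,8) _ AB(2)] assms(6,10) by blast
    moreover obtain l where "A * B = l \<cdot>\<^sub>m (B * A)"
      using comm i len by (auto simp: list_all2_conv_all_nth)
    ultimately show ?thesis by (rule phi1_mult[OF assms(1-3)])
  qed
  then have "map (phi1 p m) (map2 (*) Ms Ms') = map2 (*) (map (phi1 p m) Ms) (map (phi1 p m) Ms')"
    by (auto simp: zip_map_map case_prod_unfold)
  moreover have "set (map (phi1 p m) Ms) \<subseteq> carrier_mat p p" "set (map (phi1 p m) Ms') \<subseteq> carrier_mat p p"
    using phi1_carrier[OF assms(1-3)] assms(7,8) by auto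
  ultimately show ?thesis
    unfolding phi_def using kron_list_mult[of "map (phi1 p m) Ms" "map (phi1 p m) Ms'"] len by simp
qed

end
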